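(* Let $\mathcal{V}=\{(\xi,\eta)\in\mathbb{R}^2:\ 1,\xi,\eta \text{ linearly independent over }\mathbb{Q}\text{ and }\lambda(\xi,\eta)=1\}$. Then $\{1/\lambda_{\min}(\xi,\eta):(\xi,\eta)\in\mathcal{V}\}=[\gamma,+\infty]$, where $\gamma=(1+\sqrt5)/2$ and $1/0:=+\infty$.
   Context: For real numbers $\xi,\eta$: $\lambda(\xi,\eta)$ is the supremum of the real $\lambda>0$ such that the system $1\le |x_0|\le X$, $\max(|x_0\xi-x_1|,|x_0\eta-x_2|)\le X^{-\lambda}$ has a solution $(x_0,x_1,x_2)\in\mathbb{Z}^3\setminus\{0\}$ for arbitrarily large $X$. For $0\le\mu<\lambda(\xi,\eta)$, $\widehat{\lambda}_\mu(\xi,\eta)$ is the supremum of the real $\lambda>0$ such that the system $1\le|x_0|\le X$, $\max(|x_0\xi-x_1|,|x_0\eta-x_2|)\le\min(X^{-\lambda},|x_0|^{-\mu})$ has a solution $(x_0,x_1,x_2)\in\mathbb{Z}^3\setminus\{0\}$ for every sufficiently large $X$ (the supremum of the empty set being $0$). The map $\mu\mapsto\widehat{\lambda}_\mu(\xi,\eta)$ is non-increasing, and $\lambda_{\min}(\xi,\eta):=\inf_{0<\mu<\lambda(\xi,\eta)}\widehat{\lambda}_\mu(\xi,\eta)=\lim_{\mu\to\lambda(\xi,\eta)^-}\widehat{\lambda}_\mu(\xi,\eta)$. *)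

theory Defs
  imports "HOL-Analysis.Analysis"
begin

definition approx_sol :: "real \<Rightarrow> real \<Rightarrow> real \<Rightarrow> (int \<Rightarrow> real) \<Rightarrow> bool" where
  "approx_sol \<xi> \<eta> X bnd \<longleftrightarrow>
     (\<exists>x0 x1 x2 :: int. 1 \<le> \<bar>x0\<bar> \<and> real_of_int \<bar>x0\<bar> \<le> X \<and>
        max \<bar>of_int x0 * \<xi> - of_int x1\<bar> \<bar>of_int x0 * \<eta> - of_int x2\<bar> \<le> bnd x0)"

definition lambda_exp :: "real \<Rightarrow> real \<Rightarrow> ereal" where
  "lambda_exp \<xi> \<eta> = Sup (ereal ` {l. l > 0 \<and>
      (\<forall>X0. \<exists>X\<ge>X0. approx_sol \<xi> \<eta> X (\<lambda>_. X powr (-l)))})"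

definition lambda_hat :: "real \<Rightarrow> real \<Rightarrow> real \<Rightarrow> ereal" where
  "lambda_hat \<mu> \<xi> \<eta> =
     (let S = {l. l > 0 \<and> (\<exists>X0. \<forall>X\<ge>X0. approx_sol \<xi> \<eta> X
                  (\<lambda>x0. min (X powr (-l)) (real_of_int \<bar>x0\<bar> powr (-\<mu>))))}
      in if S = {} then 0 else Sup (ereal ` S))"

definition lambda_min :: "real \<Rightarrow> real \<Rightarrow> ereal" where
  "lambda_min \<xi> \<eta> = (INF \<mu>\<in>{\<mu>. 0 < \<mu> \<and> ereal \<mu> < lambda_exp \<xi> \<eta>}. lambda_hat \<mu> \<xi> \<eta>)"

definition recip_inf :: "ereal \<Rightarrow> ereal" where
  "recip_inf x = (if x = 0 then \<infinity> else 1 / x)"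

definition Q_lin_indep3 :: "real \<Rightarrow> real \<Rightarrow> bool" where
  "Q_lin_indep3 \<xi> \<eta> \<longleftrightarrow>
     (\<forall>a b c. a \<in> \<rat> \<and> b \<in> \<rat> \<and> c \<in> \<rat> \<and> a * 1 + b * \<xi> + c * \<eta> = 0 \<longrightarrow> a = 0 \<and> b = 0 \<and> c = 0)"

definition V_set :: "(real \<times> real) set" where
  "V_set = {(\<xi>, \<eta>). Q_lin_indep3 \<xi> \<eta> \<and> lambda_exp \<xi> \<eta> = 1}"

end

theory Submission
  imports Defs
begin

text \<open>
  Lower bound: for consecutive best approximations \<open>v\<^sub>0, v\<^sub>1, v\<^sub>2\<close> with denominators \<open>P < Q < R\<close> that are
  linearly independent, the determinant is a nonzero integer bounded by \<open>6 R err(v\<^sub>0) err(v\<^sub>1)\<close>. Uniform exponent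
  \<open>l\<close> and \<open>\<lambda> = 1\<close> give \<open>err(v\<^sub>0) \<lesssim> Q\<^sup>-\<^sup>l\<close>, \<open>err(v\<^sub>1) \<lesssim> R\<^sup>-\<^sup>l\<close> and \<open>Q\<^sup>-\<^sup>1 \<lesssim> err(v\<^sub>1)\<close>,
  whence \<open>l\<^sup>2 \<le> 1 - l\<close>, even without the side condition involving \<open>\<mu>\<close>.

  Realization: points with \<open>x\<^sub>n\<^sub>+\<^sub>3 = x\<^sub>n + a\<^sub>n x\<^sub>n\<^sub>+\<^sub>2\<close>, \<open>a\<^sub>n \<approx> exp (f\<^sub>n\<^sub>+\<^sub>2 - f\<^sub>n)\<close>, converge projectively to some
  \<open>(1 : \<xi> : \<eta>)\<close>, and \<open>x\<^sub>n\<close> has denominator about \<open>exp (f\<^sub>n\<^sub>-\<^sub>1 + f\<^sub>n\<^sub>-\<^sub>2)\<close> and error about \<open>exp (- f\<^sub>n)\<close>. So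
  approximations of exponent close to \<open>1\<close> come only from the indices with \<open>f\<^sub>n = f\<^sub>n\<^sub>-\<^sub>1 + f\<^sub>n\<^sub>-\<^sub>2\<close>, provided that
  \<open>f\<^sub>n \<le> \<theta> (f\<^sub>n\<^sub>-\<^sub>1 + f\<^sub>n\<^sub>-\<^sub>2)\<close> with \<open>\<theta> < 1\<close> at all others, and \<open>\<lambda>\<^sub>m\<^sub>i\<^sub>n\<close> is the limit of the ratios of \<open>f\<close> at
  consecutive such indices.
\<close>

subsection \<open>Determinants and rational independence\<close>

definition err :: "real \<Rightarrow> real \<Rightarrow> int \<times> int \<times> int \<Rightarrow> real" where
  "err \<xi> \<eta> = (\<lambda>(x0, x1, x2). max \<bar>of_int x0 * \<xi> - of_int x1\<bar> \<bar>of_int x0 * \<eta> - of_int x2\<bar>)"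

fun det3 :: "int \<times> int \<times> int \<Rightarrow> int \<times> int \<times> int \<Rightarrow> int \<times> int \<times> int \<Rightarrow> int" where
  "det3 (a0, a1, a2) (b0, b1, b2) (c0, c1, c2) =
     a0 * (b1 * c2 - b2 * c1) - b0 * (a1 * c2 - a2 * c1) + c0 * (a1 * b2 - a2 * b1)"

lemma approx_sol_iff:
  "approx_sol \<xi> \<eta> X bnd \<longleftrightarrow>
     (\<exists>w. 1 \<le> \<bar>fst w\<bar> \<and> real_of_int \<bar>fst w\<bar> \<le> X \<and> err \<xi> \<eta> w \<le> bnd (fst w))"
  unfolding approx_sol_def err_def by auto

lemma err_nonneg: "0 \<le> err \<xi> \<eta> w"
  by (auto simp: err_def split: prod.split)

text \<open>Subtracting multiples of the first column replaces the other two columns by the errors.\<close>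

lemma det3_bound:
  "\<bar>real_of_int (det3 a b c)\<bar> \<le>
     2 * (real_of_int \<bar>fst a\<bar> * err \<xi> \<eta> b * err \<xi> \<eta> c + real_of_int \<bar>fst b\<bar> * err \<xi> \<eta> a * err \<xi> \<eta> c
          + real_of_int \<bar>fst c\<bar> * err \<xi> \<eta> a * err \<xi> \<eta> b)"
proof -
  obtain a0 a1 a2 b0 b1 b2 c0 c1 c2 where e: "a = (a0, a1, a2)" "b = (b0, b1, b2)" "c = (c0, c1, c2)"
    by (metis prod_cases3)
  define d where "d = (\<lambda>(x::int) (y::int) z. real_of_int x * z - real_of_int y)"
  have m: "\<bar>d x0 x1 \<xi> * d y0 y2 \<eta> - d x0 x2 \<eta> * d y0 y1 \<xi>\<bar> \<le> 2 * (err \<xi> \<eta> (x0, x1, x2) * err \<xi> \<eta> (y0, y1, y2))"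
    for x0 x1 x2 y0 y1 y2
  proof -
    have "\<bar>d x0 x1 \<xi> * d y0 y2 \<eta>\<bar> \<le> err \<xi> \<eta> (x0, x1, x2) * err \<xi> \<eta> (y0, y1, y2)"
      unfolding abs_mult by (rule mult_mono) (auto simp: d_def err_def)
    moreover have "\<bar>d x0 x2 \<eta> * d y0 y1 \<xi>\<bar> \<le> err \<xi> \<eta> (x0, x1, x2) * err \<xi> \<eta> (y0, y1, y2)"
      unfolding abs_mult by (rule mult_mono) (auto simp: d_def err_def)
    ultimately show ?thesis by linarith
  qed
  have "real_of_int (det3 a b c) = a0 * (d b0 b1 \<xi> * d c0 c2 \<eta> - d b0 b2 \<eta> * d c0 c1 \<xi>)
      - b0 * (d a0 a1 \<xi> * d c0 c2 \<eta> - d a0 a2 \<eta> * d c0 c1 \<xi>)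
      + c0 * (d a0 a1 \<xi> * d b0 b2 \<eta> - d a0 a2 \<eta> * d b0 b1 \<xi>)" (is "_ = ?A - ?B + ?C")
    unfolding e d_def by (simp add: algebra_simps)
  moreover have "\<bar>?A\<bar> \<le> \<bar>real_of_int a0\<bar> * (2 * (err \<xi> \<eta> b * err \<xi> \<eta> c))"
    "\<bar>?B\<bar> \<le> \<bar>real_of_int b0\<bar> * (2 * (err \<xi> \<eta> a * err \<xi> \<eta> c))"
    "\<bar>?C\<bar> \<le> \<bar>real_of_int c0\<bar> * (2 * (err \<xi> \<eta> a * err \<xi> \<eta> b))"
    unfolding abs_mult e by (intro mult_left_mono m abs_ge_zero)+
  ultimately have "\<bar>real_of_int (det3 a b c)\<bar> \<le> \<bar>real_of_int a0\<bar> * (2 * (err \<xi> \<eta> b * err \<xi> \<eta> c))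
     + \<bar>real_of_int b0\<bar> * (2 * (err \<xi> \<eta> a * err \<xi> \<eta> c)) + \<bar>real_of_int c0\<bar> * (2 * (err \<xi> \<eta> a * err \<xi> \<eta> b))"
    by linarith
  then show ?thesis by (simp add: e algebra_simps)
qed

text \<open>Cramer's rule without division: \<open>det3 a b c\<close> times \<open>w\<close> is a
  combination of \<open>a\<close>, \<open>b\<close>, \<open>c\<close> whose coefficients are, up to
  sign, the other three determinants.\<close>

lemma det3_cramer_zero:
  assumes "det3 a b c \<noteq> 0" "det3 a b w = 0" "det3 a c w = 0" "det3 b c w = 0"
  shows "w = (0, 0, 0)"
proof -
  obtain a0 a1 a2 b0 b1 b2 c0 c1 c2 w0 w1 w2
    where e: "a = (a0, a1, a2)" "b = (b0, b1, b2)" "c = (c0, c1, c2)" "w = (w0, w1, w2)"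
    by (metis prod_cases3)
  have "det3 a b c * w0 = det3 b c w * a0 - det3 a c w * b0 + det3 a b w * c0"
    "det3 a b c * w1 = det3 b c w * a1 - det3 a c w * b1 + det3 a b w * c1"
    "det3 a b c * w2 = det3 b c w * a2 - det3 a c w * b2 + det3 a b w * c2"
    unfolding e by (simp_all add: algebra_simps)
  with assms have "det3 a b c * w0 = 0" "det3 a b c * w1 = 0" "det3 a b c * w2 = 0" by auto
  with assms(1) e show ?thesis by (metis mult_eq_0_iff)
qed

lemma Q_lin_indep3_intI:
  assumes "\<And>a b c :: int. of_int a + of_int b * \<xi> + of_int c * \<eta> = 0 \<Longrightarrow> a = 0 \<and> b = 0 \<and> c = 0"
  shows "Q_lin_indep3 \<xi> \<eta>"
  unfolding Q_lin_indep3_def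
proof (intro allI impI, elim conjE)
  fix a b c :: real
  assume "a \<in> \<rat>" "b \<in> \<rat>" "c \<in> \<rat>" and z: "a * 1 + b * \<xi> + c * \<eta> = 0"
  then obtain a1 a2 b1 b2 c1 c2 :: int where
    e: "a2 > 0" "a = of_int a1 / of_int a2" "b2 > 0" "b = of_int b1 / of_int b2"
       "c2 > 0" "c = of_int c1 / of_int c2"
    by (metis Rats_cases')
  have "of_int (a1 * b2 * c2) + of_int (b1 * a2 * c2) * \<xi> + of_int (c1 * a2 * b2) * \<eta>
      = (a * 1 + b * \<xi> + c * \<eta>) * of_int (a2 * b2 * c2)"
    using e(1,3,5) unfolding e(2,4,6) by (simp add: field_simps)
  with z have "of_int (a1 * b2 * c2) + of_int (b1 * a2 * c2) * \<xi> + of_int (c1 * a2 * b2) * \<eta> = 0"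
    by simp
  from assms[OF this] e show "a = 0 \<and> b = 0 \<and> c = 0" by simp
qed

lemma Q_lin_indep3_intD:
  assumes "Q_lin_indep3 \<xi> \<eta>" "of_int a + of_int b * \<xi> + of_int c * \<eta> = 0"
  shows "a = 0 \<and> b = 0 \<and> c = 0"
  using assms(1)[unfolded Q_lin_indep3_def, rule_format, of "of_int a" "of_int b" "of_int c"] assms(2)
  by (simp add: Rats_of_int)

text \<open>This serves in two directions. If an integer form vanishes at integer points with
  unbounded \<open>x0\<close> and bounded error, its value at \<open>(1, \<xi>, \<eta>)\<close> is
  0; if that value is 0, the form vanishes at every integer point of small enough error.\<close>

lemma abs_linear_form_le:
  "\<bar>of_int (a * x0 + b * x1 + c * x2) - of_int x0 * (of_int a + of_int b * \<xi> + of_int c * \<eta>)\<bar>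
     \<le> (\<bar>of_int b\<bar> + \<bar>of_int c\<bar>) * err \<xi> \<eta> (x0, x1, x2)" for \<xi> \<eta> :: real
proof -
  have "of_int (a * x0 + b * x1 + c * x2) - of_int x0 * (of_int a + of_int b * \<xi> + of_int c * \<eta>)
      = - (of_int b * (of_int x0 * \<xi> - of_int x1)) - of_int c * (of_int x0 * \<eta> - of_int x2)"
    by (simp add: algebra_simps)
  moreover have "\<bar>of_int b * (of_int x0 * \<xi> - of_int x1)\<bar> \<le> \<bar>of_int b\<bar> * err \<xi> \<eta> (x0, x1, x2)"
    "\<bar>of_int c * (of_int x0 * \<eta> - of_int x2)\<bar> \<le> \<bar>of_int c\<bar> * err \<xi> \<eta> (x0, x1, x2)"
    unfolding abs_mult by (auto simp: err_def intro!: mult_left_mono)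
  ultimately show ?thesis by (simp add: algebra_simps)
qed

text \<open>An integer of absolute value below 1 is 0: each of the three products in
  \<open>det3_bound\<close> is at most \<open>c * C\<^sup>2\<close>. The separate parameter
  \<open>S\<close> admits a point \<open>b\<close> that is closer than the scale \<open>Q\<close>
  demands.\<close>

lemma det3_zero_of_small:
  assumes "0 < P" "0 < Q" "Q \<le> S" "0 \<le> C"
    and a: "err \<xi> \<eta> a \<le> C / P" "real_of_int \<bar>fst a\<bar> \<le> C * (P * Q)"
    and b: "err \<xi> \<eta> b \<le> C / S" "real_of_int \<bar>fst b\<bar> \<le> C * (P * Q)"
    and w: "real_of_int \<bar>fst w\<bar> < c * (P * Q)" "err \<xi> \<eta> w < c / P" "err \<xi> \<eta> w < c / Q"
    and c: "0 < c" "6 * c * C\<^sup>2 < 1"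
  shows "det3 a b w = 0"
proof -
  have S: "0 < S" "C / S \<le> C / Q" using assms by (auto intro: divide_left_mono)
  note nn = err_nonneg[of \<xi> \<eta>]
  have b': "err \<xi> \<eta> b \<le> C / Q" using b S by linarith
  have "real_of_int \<bar>fst a\<bar> * err \<xi> \<eta> b * err \<xi> \<eta> w \<le> (C * (P * Q)) * (C / Q) * (c / P)"
    by (intro mult_mono mult_nonneg_nonneg nn a b' less_imp_le[OF w(2)]) (use assms in auto)
  moreover have "real_of_int \<bar>fst b\<bar> * err \<xi> \<eta> a * err \<xi> \<eta> w \<le> (C * (P * Q)) * (C / P) * (c / Q)"
    by (intro mult_mono mult_nonneg_nonneg nn a b less_imp_le[OF w(3)]) (use assms in auto)
  moreover have "real_of_int \<bar>fst w\<bar> * err \<xi> \<eta> a * err \<xi> \<eta> b \<le> (c * (P * Q)) * (C / P) * (C / Q)"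
    by (intro mult_mono mult_nonneg_nonneg nn a b' less_imp_le[OF w(1)]) (use assms in auto)
  ultimately have "\<bar>real_of_int (det3 a b w)\<bar> \<le> 6 * c * C\<^sup>2"
    using det3_bound[of a b w \<xi> \<eta>] assms(1,2) by (simp add: power2_eq_square mult_ac)
  then have "\<bar>real_of_int (det3 a b w)\<bar> < 1" using c by linarith
  then show ?thesis by linarith
qed

subsection \<open>A three-term recurrence\<close>

text \<open>With powers of two as multipliers the relation \<open>pow_ratio_eq\<close> is exact, so
  no rounding accumulates along the recurrence.\<close>

definition pow_ratio :: "(nat \<Rightarrow> nat) \<Rightarrow> nat \<Rightarrow> int" where
  "pow_ratio k n = 2 ^ (k (n + 2) - k n)"

fun rec_seq :: "(nat \<Rightarrow> nat) \<Rightarrow> int \<Rightarrow> int \<Rightarrow> int \<Rightarrow> nat \<Rightarrow> int" where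
  "rec_seq k a b c 0 = a"
| "rec_seq k a b c (Suc 0) = b"
| "rec_seq k a b c (Suc (Suc 0)) = c"
| "rec_seq k a b c (Suc (Suc (Suc n))) = rec_seq k a b c n + pow_ratio k n * rec_seq k a b c (n + 2)"

text \<open>\<open>2 ^ k n\<close> stands for the inverse error of the point of index
  \<open>n\<close>. The surplus \<open>n + 5\<close> in \<open>k_3\<close> makes the lower-order
  terms of the recurrence geometrically small against the main ones, so that together they cost only
  a bounded factor.\<close>

locale growth =
  fixes k :: "nat \<Rightarrow> nat"
  assumes k_pos: "1 \<le> k n"
    and k_2: "k n \<le> k (n + 2)"
    and k_3: "k n + n + 5 \<le> k (n + 3)"
begin

abbreviation X :: "nat \<Rightarrow> int" where "X \<equiv> rec_seq k 1 1 1"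

lemma pow_ratio_eq: "real_of_int (pow_ratio k n) * 2 ^ k n = 2 ^ k (n + 2)"
  using k_2[of n] by (simp add: pow_ratio_def flip: power_add)

lemma rec_3: "rec_seq k a b c (n + 3) = rec_seq k a b c n + pow_ratio k n * rec_seq k a b c (n + 2)"
  by (simp add: numeral_3_eq_3)

lemma pow_ratio_ge_1: "1 \<le> pow_ratio k n"
  by (simp add: pow_ratio_def)

section \<open>Growth of the first coordinates\<close>

lemma X_ge_1: "1 \<le> X n"
proof (induction n rule: less_induct)
  case (less n)
  consider "n = 0" | "n = 1" | "n = 2" | m where "n = m + 3"
    by (metis One_nat_def add_2_eq_Suc' add.commute less_2_cases not_less le_Suc_ex numeral_3_eq_3 numeral_2_eq_2 not_less_eq less_Suc_eq)
  then show ?case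
  proof cases
    case (4 m)
    have "1 \<le> X m" "1 \<le> X (m + 2)" using less.IH 4 by auto
    moreover have "1 * 1 \<le> pow_ratio k m * X (m + 2)"
      using pow_ratio_ge_1[of m] \<open>1 \<le> X (m + 2)\<close> by (intro mult_mono) auto
    ultimately show ?thesis by (simp add: 4 rec_3)
  qed (auto simp: numeral_2_eq_2)
qed

lemma X_Suc_ge: "X n \<le> X (Suc n)"
proof -
  consider "n = 0" | "n = 1" | m where "n = m + 2"
    by (metis One_nat_def add.commute le_Suc_ex less_2_cases not_less)
  then show ?thesis
  proof cases
    case (3 m)
    have "1 * X (m + 2) \<le> pow_ratio k m * X (m + 2)"
      using X_ge_1[of "m + 2"] pow_ratio_ge_1[of m] by (intro mult_right_mono) auto
    moreover have "Suc n = m + 3" using 3 by simp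
    ultimately show ?thesis using 3 X_ge_1[of m] rec_3[of 1 1 1 m] by simp
  qed auto
qed

lemma X_mono: "m \<le> n \<Longrightarrow> X m \<le> X n"
  by (rule lift_Suc_mono_le[of X, OF X_Suc_ge])

lemma X_step: "2 ^ k (n + 2) * real_of_int (X (n + 2)) \<le> 2 ^ k n * real_of_int (X (n + 3))"
proof -
  have "2 ^ k (n + 2) * real_of_int (X (n + 2)) = 2 ^ k n * real_of_int (pow_ratio k n * X (n + 2))"
    by (simp only: pow_ratio_eq[symmetric] mult_ac of_int_mult)
  also have "\<dots> \<le> 2 ^ k n * real_of_int (X (n + 3))"
    using X_ge_1[of n] unfolding rec_3 by (intro mult_left_mono) auto
  finally show ?thesis .
qed

text \<open>Dropping the summand \<open>X n\<close> from the recurrence leaves a telescoping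
  product; the constant is what the initial value \<open>X 2 = 1\<close> costs.\<close>

lemma X_lower: "2 ^ (k (n + 1) + k n) \<le> 2 ^ (k 1 + k 0) * real_of_int (X (n + 2))"
proof (induction n)
  case (Suc n)
  have "2 ^ k n * 2 ^ (k (n + 2) + k (n + 1)) = 2 ^ k (n + 2) * (2 ^ (k (n + 1) + k n) :: real)"
    by (simp add: power_add)
  also have "\<dots> \<le> 2 ^ k (n + 2) * (2 ^ (k 1 + k 0) * real_of_int (X (n + 2)))"
    using Suc by (intro mult_left_mono) auto
  also have "\<dots> = 2 ^ (k 1 + k 0) * (2 ^ k (n + 2) * real_of_int (X (n + 2)))"
    by simp
  also have "\<dots> \<le> 2 ^ (k 1 + k 0) * (2 ^ k n * real_of_int (X (n + 3)))"
    using X_step[of n] by (intro mult_left_mono) auto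
  finally have "2 ^ k n * 2 ^ (k (n + 2) + k (n + 1)) \<le> 2 ^ k n * (2 ^ (k 1 + k 0) * real_of_int (X (n + 3)))"
    by (simp add: mult_ac)
  then show ?case by (simp add: numeral_3_eq_3)
qed (simp add: numeral_2_eq_2)

text \<open>The increasing factor \<open>2 - 1 / 2 ^ n\<close> lets the induction close: its
  increment from \<open>m\<close> to \<open>Suc m\<close> is exactly the room for the summand
  \<open>X m\<close>.\<close>

lemma X_upper: "real_of_int (X (n + 2)) \<le> (2 - 1 / 2 ^ n) * 2 ^ (k (n + 1) + k n)"
proof (induction n rule: less_induct)
  case (less n)
  show ?case
  proof (cases n)
    case 0
    then show ?thesis by (simp add: numeral_2_eq_2)
  next
    case (Suc m)
    have small: "real_of_int (X m) \<le> 1 / 2 ^ Suc m * 2 ^ (k (m + 2) + k (m + 1))"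
    proof (cases "m < 2")
      case True
      have "m + 1 \<le> k (m + 2) + k (m + 1)"
        using True k_pos[of 2] k_pos[of 1] k_3[of 0] k_pos[of 3]
        by (cases m) (auto simp: numeral_2_eq_2 numeral_3_eq_3)
      then have "(2::real) ^ (m + 1) \<le> 2 ^ (k (m + 2) + k (m + 1))"
        by (rule power_increasing) auto
      moreover have "X m = 1" using True by (cases m) (auto simp: less_Suc_eq)
      ultimately show ?thesis by (simp add: field_simps)
    next
      case False
      then obtain j where j: "m = j + 2" by (metis add.commute le_Suc_ex not_less)
      have "real_of_int (X m) \<le> (2 - 1 / 2 ^ j) * 2 ^ (k (j + 1) + k j)"
        using less.IH[of j] Suc j by simp
      also have "\<dots> \<le> 2 * 2 ^ (k (j + 1) + k j)"
        by (intro mult_right_mono) auto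
      finally have "2 ^ Suc m * real_of_int (X m) \<le> 2 ^ Suc m * (2 * 2 ^ (k (j + 1) + k j))"
        by (intro mult_left_mono) auto
      also have "\<dots> = 2 ^ (Suc m + 1 + (k (j + 1) + k j))"
        by (simp add: power_add)
      also have "\<dots> \<le> 2 ^ (k (m + 2) + k (m + 1))"
        using k_3[of j] k_3[of "j + 1"] j
        by (intro power_increasing) (auto simp: eval_nat_numeral)
      finally show ?thesis by (simp add: field_simps)
    qed
    have "n + 2 = m + 3" using Suc by simp
    then have split: "real_of_int (X (n + 2)) = real_of_int (X m) + real_of_int (pow_ratio k m) * X (m + 2)"
      by (simp only: rec_3 of_int_add of_int_mult)
    have "real_of_int (pow_ratio k m) * X (m + 2)
        \<le> pow_ratio k m * ((2 - 1 / 2 ^ m) * 2 ^ (k (m + 1) + k m))"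
      using less.IH[of m] Suc pow_ratio_ge_1[of m] by (intro mult_left_mono) auto
    also have "\<dots> = (2 - 1 / 2 ^ m) * ((real_of_int (pow_ratio k m) * 2 ^ k m) * 2 ^ k (m + 1))"
      by (simp add: power_add mult_ac)
    also have "\<dots> = (2 - 1 / 2 ^ m) * 2 ^ (k (m + 2) + k (m + 1))"
      unfolding pow_ratio_eq by (simp add: power_add)
    finally have "real_of_int (X (n + 2))
        \<le> (1 / 2 ^ Suc m + (2 - 1 / 2 ^ m)) * 2 ^ (k (m + 2) + k (m + 1))"
      using small split unfolding distrib_right by linarith
    also have "1 / 2 ^ Suc m + (2 - 1 / 2 ^ m) = (2 - 1 / 2 ^ n :: real)"
      using Suc by (simp add: field_simps)
    finally show ?thesis using Suc by simp
  qed
qed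

lemma X_upper': "real_of_int (X (n + 2)) \<le> 2 * (2 ^ k n * 2 ^ k (n + 1))"
proof -
  have "(2 - 1 / 2 ^ n) * 2 ^ (k (n + 1) + k n) \<le> 2 * (2 ^ (k (n + 1) + k n) :: real)"
    by (intro mult_right_mono) auto
  with X_upper[of n] have "real_of_int (X (n + 2)) \<le> 2 * 2 ^ (k (n + 1) + k n)" by linarith
  then show ?thesis by (simp only: power_add mult_ac)
qed

section \<open>Minors of consecutive points and projective convergence\<close>

definition wedge :: "int \<Rightarrow> int \<Rightarrow> int \<Rightarrow> nat \<Rightarrow> int" where
  "wedge a b c n = X n * rec_seq k a b c (Suc n) - rec_seq k a b c n * X (Suc n)"

text \<open>The recurrence for the minors is again of three-term type: \<open>x\<^sub>n\<^sub>+\<^sub>3\<close> and \<open>x\<^sub>n\<close> agree modulo \<open>x\<^sub>n\<^sub>+\<^sub>2\<close>.\<close>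

lemma wedge_rec: "wedge a b c (n + 3) = wedge a b c n - pow_ratio k n * wedge a b c (n + 1)"
proof -
  define Y where "Y = rec_seq k a b c"
  have e: "n + 3 = Suc (Suc (Suc n))" "Suc (n + 3) = Suc (Suc (Suc (Suc n)))" by auto
  have XY: "X (n + 3) = X n + pow_ratio k n * X (n + 2)" "Y (n + 3) = Y n + pow_ratio k n * Y (n + 2)"
    "X (n + 4) = X (n + 1) + pow_ratio k (n + 1) * X (n + 3)"
    "Y (n + 4) = Y (n + 1) + pow_ratio k (n + 1) * Y (n + 3)"
    using rec_3[of _ _ _ n] rec_3[of _ _ _ "n + 1"] by (simp_all add: Y_def add_ac)
  have "wedge a b c (n + 3) = X (n + 3) * Y (n + 4) - Y (n + 3) * X (n + 4)"
    by (simp add: wedge_def Y_def eval_nat_numeral)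
  also have "\<dots> = X (n + 3) * Y (n + 1) - Y (n + 3) * X (n + 1)"
    unfolding XY(3,4) by (simp add: algebra_simps)
  also have "\<dots> = X n * Y (n + 1) - Y n * X (n + 1) - pow_ratio k n * (X (n + 1) * Y (n + 2) - Y (n + 1) * X (n + 2))"
    unfolding XY(1,2) by (simp add: algebra_simps)
  finally show ?thesis by (simp add: wedge_def Y_def)
qed

text \<open>As in \<open>X_upper\<close>, the growing factor absorbs the lower-order term
  \<open>wedge a b c n\<close> of \<open>wedge_rec\<close>.\<close>

lemma wedge_bound:
  assumes "\<bar>wedge a b c 0\<bar> \<le> 1" "\<bar>wedge a b c 1\<bar> \<le> 1" "\<bar>wedge a b c 2\<bar> \<le> 1"
  shows "real_of_int \<bar>wedge a b c (n + 1)\<bar> \<le> (2 - 1 / 2 ^ n) * 2 ^ k n"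
proof (induction n rule: less_induct)
  case (less n)
  define D where "D = (\<lambda>n. real_of_int \<bar>wedge a b c n\<bar>)"
  have one: "(1::real) \<le> 2 ^ k n" for n by simp
  show ?case
  proof (cases "n < 2")
    case True
    then consider "n = 0" | "n = 1" by linarith
    then show ?thesis
    proof cases
      case 1
      have "real_of_int \<bar>wedge a b c 1\<bar> \<le> 1" using assms by simp
      also have "1 \<le> (2 - 1 / 2 ^ 0) * (2::real) ^ k 0" using one[of 0] by simp
      finally show ?thesis using 1 by simp
    next
      case 2
      have "real_of_int \<bar>wedge a b c 2\<bar> \<le> 1" using assms by simp
      also have "1 \<le> (2 - 1 / 2 ^ 1) * (2::real) ^ k 1"
        using mult_mono[of 1 "3 / 2 :: real" 1 "2 ^ k 1"] by simp
      finally show ?thesis using 2 by (simp add: numeral_2_eq_2)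
    qed
  next
    case False
    then obtain m where m: "n = m + 2" by (metis add.commute le_Suc_ex not_less)
    have small: "D m \<le> 1 / 2 ^ (m + 1) * 2 ^ k (m + 2)"
    proof (cases m)
      case 0
      have "(2::real) ^ 1 \<le> 2 ^ k 2" using k_pos[of 2] by (intro power_increasing) auto
      moreover have "D 0 \<le> 1" using assms by (simp add: D_def)
      ultimately show ?thesis using 0 by (simp add: numeral_2_eq_2)
    next
      case (Suc j)
      have "D m \<le> (2 - 1 / 2 ^ j) * 2 ^ k j"
        using less.IH[of j] Suc m by (simp add: D_def)
      also have "\<dots> \<le> 2 * 2 ^ k j" by (intro mult_right_mono) auto
      finally have "2 ^ (m + 1) * D m \<le> 2 ^ (m + 1) * (2 * 2 ^ k j)"
        by (intro mult_left_mono) auto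
      also have "\<dots> = 2 ^ (m + 2 + k j)" by (simp add: power_add)
      also have "\<dots> \<le> 2 ^ k (m + 2)"
        using k_3[of j] Suc by (intro power_increasing) (auto simp: eval_nat_numeral)
      finally show ?thesis by (simp add: field_simps)
    qed
    have "n + 1 = m + 3" using m by simp
    then have "D (n + 1) \<le> D m + pow_ratio k m * D (m + 1)"
      using wedge_rec[of a b c m] pow_ratio_ge_1[of m] abs_triangle_ineq4[of "wedge a b c m" "pow_ratio k m * wedge a b c (m + 1)"]
      unfolding D_def \<open>n + 1 = m + 3\<close> by (simp add: abs_mult flip: of_int_mult of_int_add of_int_abs)
    also have "pow_ratio k m * D (m + 1) \<le> pow_ratio k m * ((2 - 1 / 2 ^ m) * 2 ^ k m)"
      using less.IH[of m] m pow_ratio_ge_1[of m] unfolding D_def by (intro mult_left_mono) auto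
    also have "\<dots> = (2 - 1 / 2 ^ m) * 2 ^ k (m + 2)"
      by (simp only: pow_ratio_eq[symmetric] mult_ac)
    finally have "D (n + 1) \<le> (1 / 2 ^ (m + 1) + (2 - 1 / 2 ^ m)) * 2 ^ k (m + 2)"
      using small unfolding distrib_right by linarith
    also have "\<dots> \<le> (2 - 1 / 2 ^ n) * 2 ^ k (m + 2)"
      by (intro mult_right_mono) (auto simp: m field_simps)
    finally show ?thesis by (simp add: D_def m)
  qed
qed

text \<open>The quotients \<open>p n\<close> form a Cauchy sequence whose steps are dominated by a
  sequence \<open>t\<close> that at least halves each time. Hence the distance of \<open>p n\<close>
  to the limit is of order \<open>t n\<close>, and multiplication by \<open>X n\<close> leaves order
  \<open>1 / 2 ^ k n\<close>.\<close>

lemma rec_seq_limit: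
  assumes "\<bar>wedge a b c 0\<bar> \<le> 1" "\<bar>wedge a b c 1\<bar> \<le> 1" "\<bar>wedge a b c 2\<bar> \<le> 1"
  obtains \<xi> C :: real where "\<And>n. \<bar>X n * \<xi> - rec_seq k a b c n\<bar> \<le> C / 2 ^ k n"
proof -
  define Y where "Y = rec_seq k a b c"
  define p where "p = (\<lambda>n. real_of_int (Y n) / X n)"
  define t where "t = (\<lambda>n. 1 / (2 ^ k n * real_of_int (X n)))"
  define K :: real where "K = 2 * 2 ^ (k 1 + k 0)"
  have Xp: "0 < real_of_int (X n)" for n using X_ge_1[of n] by simp
  have tp: "0 < t n" for n using Xp[of n] unfolding t_def by (intro divide_pos_pos mult_pos_pos) auto
  \<comment> \<open>The step is a minor of order \<open>2 ^ k (n - 1)\<close> divided by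
    \<open>X n * X (n + 1)\<close>, where \<open>X (n + 1)\<close> is at least of order
    \<open>2 ^ (k n + k (n - 1))\<close> by \<open>X_lower\<close>.\<close>
  have step: "\<bar>p (n + 1) - p n\<bar> \<le> K * t n" if n: "2 \<le> n" for n
  proof -
    obtain m where m: "n = m + 1" using n by (metis One_nat_def Suc_1 Suc_eq_plus1 Suc_le_D)
    have diff: "p (n + 1) - p n = wedge a b c n / (real_of_int (X n) * X (n + 1))"
      using Xp[of n] Xp[of "n + 1"] by (simp add: p_def wedge_def Y_def field_simps)
    have "real_of_int \<bar>wedge a b c n\<bar> \<le> 2 * 2 ^ k m"
    proof -
      have "(2 - 1 / 2 ^ m) * 2 ^ k m \<le> 2 * (2 ^ k m :: real)" by (intro mult_right_mono) auto
      with wedge_bound[OF assms, of m] show ?thesis unfolding m by linarith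
    qed
    then have "real_of_int \<bar>wedge a b c n\<bar> * 2 ^ k n \<le> 2 * 2 ^ k m * 2 ^ k n"
      by (intro mult_right_mono) auto
    also have "\<dots> \<le> K * real_of_int (X (n + 1))"
      using X_lower[of m] m by (simp add: K_def power_add mult_ac)
    finally have "real_of_int \<bar>wedge a b c n\<bar> * 2 ^ k n \<le> K * real_of_int (X (n + 1))" .
    then show ?thesis
      using Xp[of n] Xp[of "n + 1"] unfolding diff by (simp add: t_def abs_mult field_simps)
  qed
  have half: "t (n + 1) \<le> t n / 2" if n: "2 \<le> n" for n
  proof -
    obtain m where m: "n = m + 2" using n by (metis add.commute le_Suc_ex)
    have "2 * (2 ^ k m * (2 ^ k (m + 2) * real_of_int (X (m + 2)))) \<le> 2 * (2 ^ k m * (2 ^ k m * real_of_int (X (m + 3))))"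
      using X_step[of m] by (intro mult_left_mono) auto
    also have "\<dots> = 2 ^ k m * (2 ^ (k m + 1) * real_of_int (X (m + 3)))" by (simp add: power_add mult_ac)
    also have "\<dots> \<le> 2 ^ k m * (2 ^ k (m + 3) * real_of_int (X (m + 3)))"
      using k_3[of m] Xp[of "m + 3"] by (intro mult_left_mono mult_right_mono power_increasing) auto
    finally have "2 * (2 ^ k n * real_of_int (X n)) \<le> 2 ^ k (n + 1) * real_of_int (X (n + 1))"
      using m by (simp add: numeral_3_eq_3)
    then show ?thesis using Xp[of n] Xp[of "n + 1"] by (simp add: t_def field_simps)
  qed
  \<comment> \<open>Subtracting \<open>t (n + m)\<close> makes the bound telescope, since halving
    gives \<open>t j \<le> 2 * (t j - t (j + 1))\<close>.\<close>
  have far: "\<bar>p (n + m) - p n\<bar> \<le> 2 * K * (t n - t (n + m))" if n: "2 \<le> n" for n m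
  proof (induction m)
    case (Suc m)
    have "K * t (n + m) \<le> 2 * K * (t (n + m) - t (n + m + 1))"
      using half[of "n + m"] n by (simp add: K_def algebra_simps)
    then show ?case using Suc step[of "n + m"] n by (simp add: algebra_simps)
  qed simp
  have far': "\<bar>p m - p n\<bar> \<le> 2 * K * t n" if "2 \<le> n" "n \<le> m" for n m
  proof -
    have "2 * K * (t n - t m) \<le> 2 * K * t n" using tp[of m] by (intro mult_left_mono) (auto simp: K_def)
    then show ?thesis using far[of n "m - n"] that by simp
  qed
  have tb: "t (n + 2) \<le> t 2 * (1 / 2) ^ n" for n
  proof (induction n)
    case (Suc n)
    then show ?case using half[of "n + 2"] by simp
  qed (simp add: numeral_2_eq_2)
  have "(\<lambda>n. t 2 * (1 / 2) ^ n) \<longlonglongrightarrow> t 2 * 0"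
    by (intro tendsto_intros LIMSEQ_power_zero) auto
  then have "(\<lambda>n. t (n + 2)) \<longlonglongrightarrow> 0"
    using tb tp by (intro real_tendsto_sandwich[of "\<lambda>_. 0" "\<lambda>n. t (n + 2)" _ "\<lambda>n. t 2 * (1 / 2) ^ n"])
      (auto simp: less_imp_le)
  then have t0: "(\<lambda>n. 2 * (2 * K * t (n + 2))) \<longlonglongrightarrow> 0"
    by (auto intro!: tendsto_mult_right_zero)
  have "Cauchy p"
  proof (rule metric_CauchyI)
    fix e :: real assume "0 < e"
    then obtain N where N: "2 * (2 * K * t (N + 2)) < e"
      using order_tendstoD(2)[OF t0] by (meson eventually_happens' sequentially_bot)
    have "dist (p m) (p n) < e" if "N + 2 \<le> m" "N + 2 \<le> n" for m n
      using far'[of "N + 2" m] far'[of "N + 2" n] that N by (simp add: dist_real_def)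
    then show "\<exists>M. \<forall>m\<ge>M. \<forall>n\<ge>M. dist (p m) (p n) < e" by blast
  qed
  then obtain \<xi> where lim: "p \<longlonglongrightarrow> \<xi>" using Cauchy_convergent convergent_def by blast
  have close: "\<bar>X n * \<xi> - Y n\<bar> \<le> 2 * K / 2 ^ k n" if n: "2 \<le> n" for n
  proof -
    have "(\<lambda>m. \<bar>p m - p n\<bar>) \<longlonglongrightarrow> \<bar>\<xi> - p n\<bar>" by (intro tendsto_intros lim)
    then have "\<bar>\<xi> - p n\<bar> \<le> 2 * K * t n"
      by (rule LIMSEQ_le_const2) (use far'[OF n] in blast)
    then have "real_of_int (X n) * \<bar>\<xi> - p n\<bar> \<le> X n * (2 * K * t n)"
      using Xp[of n] by (intro mult_left_mono) auto
    moreover have "real_of_int (X n) * \<bar>\<xi> - p n\<bar> = \<bar>X n * \<xi> - Y n\<bar>"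
    proof -
      have "X n * \<xi> - Y n = X n * (\<xi> - p n)" using Xp[of n] by (simp add: p_def field_simps)
      then show ?thesis using Xp[of n] by (simp add: abs_mult)
    qed
    moreover have "X n * (2 * K * t n) = 2 * K / 2 ^ k n" using Xp[of n] by (simp add: t_def)
    ultimately show ?thesis by simp
  qed
  \<comment> \<open>The last two summands cover the indices 0 and 1, which \<open>close\<close>
    leaves out.\<close>
  define C where "C = 2 * K + 2 ^ k 0 * \<bar>X 0 * \<xi> - Y 0\<bar> + 2 ^ k 1 * \<bar>X 1 * \<xi> - Y 1\<bar>"
  have "\<bar>X n * \<xi> - Y n\<bar> \<le> C / 2 ^ k n" for n
  proof -
    consider "n = 0" | "n = 1" | "2 \<le> n" by linarith
    then show ?thesis
    proof cases
      case 1 then show ?thesis by (simp add: C_def K_def field_simps add_nonneg_nonneg)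
    next
      case 2 then show ?thesis by (simp add: C_def K_def field_simps add_nonneg_nonneg)
    next
      case 3
      have "2 * K / 2 ^ k n \<le> C / 2 ^ k n" by (intro divide_right_mono) (auto simp: C_def)
      then show ?thesis using close[OF 3] by simp
    qed
  qed
  then show ?thesis using that unfolding Y_def by blast
qed

definition pt :: "nat \<Rightarrow> int \<times> int \<times> int" where
  "pt n = (X n, rec_seq k 0 1 0 n, rec_seq k 0 0 1 n)"

text \<open>Modulo \<open>pt (n + 2)\<close> the new point \<open>pt (n + 3)\<close> equals
  \<open>pt n\<close>, so passing to the next triple is a cyclic, hence even, permutation of the
  columns.\<close>

lemma det3_pt: "det3 (pt n) (pt (n + 1)) (pt (n + 2)) = 1"
proof (induction n)
  case (Suc n)
  have "pt (Suc n + 2) = (X n + pow_ratio k n * X (n + 2),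
      rec_seq k 0 1 0 n + pow_ratio k n * rec_seq k 0 1 0 (n + 2),
      rec_seq k 0 0 1 n + pow_ratio k n * rec_seq k 0 0 1 (n + 2))"
    unfolding pt_def using rec_3[of _ _ _ n] by (simp add: numeral_3_eq_3)
  then have "det3 (pt (Suc n)) (pt (Suc n + 1)) (pt (Suc n + 2)) = det3 (pt n) (pt (n + 1)) (pt (n + 2))"
    by (simp add: pt_def algebra_simps)
  with Suc show ?case by simp
qed (simp add: pt_def numeral_2_eq_2)

text \<open>The initial rows \<open>0 1 0\<close> and \<open>0 0 1\<close> make each of the three
  initial minors 0, 1 or -1, whatever the value of \<open>pow_ratio k 0\<close>.\<close>

lemma limit_point:
  obtains \<xi> \<eta> C where "0 \<le> C" "\<And>n. err \<xi> \<eta> (pt n) \<le> C / 2 ^ k n"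
proof -
  obtain \<xi> C :: real where \<xi>: "\<And>n. \<bar>X n * \<xi> - rec_seq k 0 1 0 n\<bar> \<le> C / 2 ^ k n"
    by (rule rec_seq_limit[of 0 1 0]) (auto simp: wedge_def eval_nat_numeral pow_ratio_def)
  obtain \<eta> C' :: real where \<eta>: "\<And>n. \<bar>X n * \<eta> - rec_seq k 0 0 1 n\<bar> \<le> C' / 2 ^ k n"
    by (rule rec_seq_limit[of 0 0 1]) (auto simp: wedge_def eval_nat_numeral pow_ratio_def)
  have "err \<xi> \<eta> (pt n) \<le> max 0 (max C C') / 2 ^ k n" for n
  proof -
    have "C / 2 ^ k n \<le> max 0 (max C C') / 2 ^ k n" "C' / 2 ^ k n \<le> max 0 (max C C') / 2 ^ k n"
      by (auto intro!: divide_right_mono)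
    then show ?thesis using \<xi>[of n] \<eta>[of n] by (simp add: err_def pt_def)
  qed
  then show ?thesis using that[of "max 0 (max C C')"] by auto
qed

end

subsection \<open>Exponents from a sequence of good points\<close>

lemma eventually_powr_neg_less:
  fixes c :: real
  assumes "0 < s" "0 < c"
  shows "eventually (\<lambda>X. X powr (-s) < c) at_top"
proof -
  have "((\<lambda>X::real. X powr (-s)) \<longlongrightarrow> 0) at_top"
    by (rule tendsto_neg_powr) (use assms in \<open>auto intro: filterlim_ident\<close>)
  then show ?thesis using assms by (rule_tac order_tendstoD(2))
qed

text \<open>The assumption \<open>0 \<le> r\<close> accounts for the empty set, where
  \<open>lambda_hat\<close> takes the default value 0.\<close>

lemma lambda_hat_le_of_bound:
  assumes "\<And>l. l \<in> {l. 0 < l \<and> (\<exists>X0. \<forall>X\<ge>X0. approx_sol \<xi> \<eta> X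
      (\<lambda>x0. min (X powr (-l)) (real_of_int \<bar>x0\<bar> powr (-\<mu>))))} \<Longrightarrow> l \<le> r" "0 \<le> r"
  shows "lambda_hat \<mu> \<xi> \<eta> \<le> ereal r"
proof -
  have "(if S = {} then 0 else Sup (ereal ` S)) \<le> ereal r" if "\<And>l. l \<in> S \<Longrightarrow> l \<le> r" for S
    using that assms(2) by (auto intro!: Sup_least)
  from this[OF assms(1)] show ?thesis unfolding lambda_hat_def Let_def by blast
qed

lemma lambda_hat_nonneg: "0 \<le> lambda_hat \<mu> \<xi> \<eta>"
proof -
  have "0 \<le> Sup (ereal ` S)" if "l \<in> S" "0 < l" for S and l :: real
    using that by (intro order_trans[of 0 "ereal l" "Sup (ereal ` S)"] Sup_upper) auto
  then have "0 \<le> (if S = {} then 0 else Sup (ereal ` S))" if "\<And>l. l \<in> S \<Longrightarrow> 0 < l" for S :: "real set"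
    using that by (metis ex_in_conv order_refl)
  then show ?thesis unfolding lambda_hat_def Let_def by (metis (no_types, lifting) mem_Collect_eq)
qed

text \<open>\<open>E i\<close> bounds the first coordinate of \<open>v i\<close> and its inverse
  error, both up to \<open>C\<close>, so these points have exponent near 1. By
  \<open>dichotomy\<close> any other integer point either has exponent at most
  \<open>\<theta>\<close> or is, up to constants, no better than some \<open>v i\<close>; once
  \<open>\<mu>\<close> exceeds \<open>\<theta>\<close>, only the \<open>v i\<close> matter.\<close>

locale good_points =
  fixes \<xi> \<eta> :: real and v :: "nat \<Rightarrow> int \<times> int \<times> int" and E :: "nat \<Rightarrow> real" and C c \<theta> r :: real
  assumes C: "1 \<le> C" and c: "0 < c" and \<theta>: "0 < \<theta>" "\<theta> < 1"
    and E_mono: "strict_mono E" and E_top: "filterlim E at_top sequentially" and E_gt_1: "1 < E i"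
    and v_ge_1: "1 \<le> fst (v i)" and v_le: "fst (v i) \<le> C * E i" and v_err: "err \<xi> \<eta> (v i) \<le> C / E i"
    and dichotomy: "1 \<le> \<bar>fst w\<bar> \<Longrightarrow> c * real_of_int \<bar>fst w\<bar> powr (-\<theta>) \<le> err \<xi> \<eta> w \<or>
      (\<exists>i. c * E i \<le> real_of_int \<bar>fst w\<bar> \<and> c / E i \<le> err \<xi> \<eta> w)"
    and ratio: "(\<lambda>i. ln (E i) / ln (E (Suc i))) \<longlonglongrightarrow> r"
begin

lemma r_nonneg: "0 \<le> r"
proof (rule LIMSEQ_le_const[OF ratio], intro exI allI impI)
  fix n show "0 \<le> ln (E n) / ln (E (Suc n))" using E_gt_1[of n] E_gt_1[of "Suc n"] by simp
qed

lemma E_pos: "0 < E i" using E_gt_1[of i] by simp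

lemma lnE_top: "filterlim (\<lambda>i. ln (E i)) at_top sequentially"
  by (rule filterlim_compose[OF ln_at_top E_top])

text \<open>Both branches of \<open>dichotomy\<close> bound the exponent by 1: the first because
  \<open>\<theta> < 1\<close>, the second because \<open>E i\<close> is at most the height divided
  by \<open>c\<close>.\<close>

lemma err_lower: 
  assumes "1 \<le> \<bar>fst w\<bar>"
  shows "min c (c\<^sup>2) / real_of_int \<bar>fst w\<bar> \<le> err \<xi> \<eta> w"
  using dichotomy[OF assms]
proof
  define h where "h = real_of_int \<bar>fst w\<bar>"
  have h: "1 \<le> h" using assms by (simp add: h_def)
  { assume "c * real_of_int \<bar>fst w\<bar> powr (-\<theta>) \<le> err \<xi> \<eta> w"
    moreover have "c * h powr (-1) \<le> c * h powr (-\<theta>)"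
      using h \<theta> c by (intro mult_left_mono powr_mono) auto
    moreover have "min c (c\<^sup>2) / h \<le> c * h powr (-1)"
      using h by (simp add: powr_minus_divide divide_right_mono)
    ultimately show ?thesis by (simp add: h_def) }
  { assume "\<exists>i. c * E i \<le> real_of_int \<bar>fst w\<bar> \<and> c / E i \<le> err \<xi> \<eta> w"
    then obtain i where i: "c * E i \<le> h" "c / E i \<le> err \<xi> \<eta> w" by (auto simp: h_def)
    have "c * (c * E i) \<le> c * h" using i c by (intro mult_left_mono) auto
    then have "c\<^sup>2 / h \<le> c / E i" using h E_pos[of i] by (simp add: field_simps power2_eq_square)
    moreover have "min c (c\<^sup>2) / h \<le> c\<^sup>2 / h" using h by (simp add: divide_right_mono)
    ultimately show ?thesis using i by (simp add: h_def) }
qed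

lemma lambda_exp_eq_1: "lambda_exp \<xi> \<eta> = 1"
proof (rule antisym)
  show "lambda_exp \<xi> \<eta> \<le> 1"
    unfolding lambda_exp_def
  proof (rule Sup_least, clarify)
    fix l :: real
    assume l: "0 < l" "\<forall>X0. \<exists>X\<ge>X0. approx_sol \<xi> \<eta> X (\<lambda>_. X powr - l)"
    show "ereal l \<le> 1"
    proof (rule ccontr)
      assume "\<not> ereal l \<le> 1"
      then have l1: "0 < l - 1" by (simp add: one_ereal_def)
      have "0 < min c (c\<^sup>2)" using c by simp
      from eventually_powr_neg_less[OF l1 this] obtain X0 where X0: "\<And>X. X0 \<le> X \<Longrightarrow> X powr (- (l - 1)) < min c (c\<^sup>2)"
        by (auto simp: eventually_at_top_linorder)
      obtain X w where X: "max 1 X0 \<le> X" and w: "1 \<le> \<bar>fst w\<bar>" "real_of_int \<bar>fst w\<bar> \<le> X" "err \<xi> \<eta> w \<le> X powr - l"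
        using l(2) unfolding approx_sol_iff by blast
      have "min c (c\<^sup>2) / X \<le> min c (c\<^sup>2) / real_of_int \<bar>fst w\<bar>"
        using w X c by (intro divide_left_mono) auto
      also have "\<dots> \<le> X powr (-l)" using err_lower[OF w(1)] w(3) by linarith
      finally have "min c (c\<^sup>2) \<le> X powr (-l) * X" using X by (simp add: field_simps)
      also have "\<dots> = X powr (- (l - 1))" using X powr_add[of X "-l" 1] by (simp add: algebra_simps)
      finally show False using X0[of X] X by linarith
    qed
  qed
  show "1 \<le> lambda_exp \<xi> \<eta>"
  proof (rule ccontr)
    assume "\<not> 1 \<le> lambda_exp \<xi> \<eta>"
    then have "max 0 (lambda_exp \<xi> \<eta>) < 1" by (simp add: not_le)
    then obtain l where "max 0 (lambda_exp \<xi> \<eta>) < ereal l" "ereal l < 1"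
      using ereal_dense2 by blast
    then have l: "0 < l" "l < 1" "lambda_exp \<xi> \<eta> < ereal l" by (auto simp: zero_ereal_def one_ereal_def)
    have "\<exists>X\<ge>X0. approx_sol \<xi> \<eta> X (\<lambda>_. X powr - l)" for X0
    proof -
      have "0 < 1 - l" "0 < 1 / C\<^sup>2" using l C by auto
      from eventually_powr_neg_less[OF this] obtain X1 where X1: "\<And>X. X1 \<le> X \<Longrightarrow> X powr (- (1 - l)) < 1 / C\<^sup>2"
        by (auto simp: eventually_at_top_linorder)
      obtain i where i: "max X0 (max X1 1) \<le> E i"
        using E_top by (metis eventually_happens' filterlim_at_top sequentially_bot)
      \<comment> \<open>The error of \<open>v i\<close> is at most
        \<open>C / E i = C\<^sup>2 / X\<close>; for \<open>l < 1\<close> the surplus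
        \<open>X powr (- (1 - l))\<close> absorbs \<open>C\<^sup>2\<close>.\<close>
      define X where "X = C * E i"
      have "E i * 1 \<le> E i * C" using C E_pos[of i] by (intro mult_left_mono) auto
      then have X: "X0 \<le> X" "X1 \<le> X" "1 \<le> X" using i unfolding X_def max.bounded_iff mult_1_right mult.commute[of C] by linarith+
      have "C / E i = C\<^sup>2 * X powr (-1)" using C E_pos[of i] by (simp add: X_def power2_eq_square powr_minus_divide)
      also have "X powr (-1) = X powr (- (1 - l)) * X powr (-l)" by (simp flip: powr_add)
      also have "C\<^sup>2 * (X powr (- (1 - l)) * X powr (-l)) \<le> C\<^sup>2 * (1 / C\<^sup>2 * X powr (-l))"
        using X1[OF X(2)] by (intro mult_left_mono mult_right_mono) auto
      also have "\<dots> = X powr (-l)" using C by simp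
      finally have "err \<xi> \<eta> (v i) \<le> X powr (-l)" using v_err[of i] by linarith
      then show ?thesis using X v_le[of i] v_ge_1[of i] unfolding approx_sol_iff X_def
        by (intro exI[of _ "C * E i"] conjI exI[of _ "v i"]) auto
    qed
    then have "ereal l \<le> lambda_exp \<xi> \<eta>"
      unfolding lambda_exp_def using l by (intro Sup_upper imageI) auto
    with l show False by simp
  qed
qed

text \<open>For \<open>X\<close> from \<open>C * E i\<close> up to \<open>C * E (Suc i)\<close> the
  point \<open>v i\<close> is used. The upper end is the worst case, where its error of order
  \<open>1 / E i\<close> is about \<open>X powr (- r)\<close>. Since the \<open>v i\<close> have
  exponent near 1, they also meet the condition with \<open>\<mu> < 1\<close>.\<close>

lemma lambda_hat_ge:
  assumes \<mu>: "0 < \<mu>" "\<mu> < 1"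
  shows "ereal r \<le> lambda_hat \<mu> \<xi> \<eta>"
proof -
  define S where "S = {l. l > 0 \<and> (\<exists>X0. \<forall>X\<ge>X0. approx_sol \<xi> \<eta> X
                  (\<lambda>x0. min (X powr (-l)) (real_of_int \<bar>x0\<bar> powr (-\<mu>))))}"
  have hat: "lambda_hat \<mu> \<xi> \<eta> = (if S = {} then 0 else Sup (ereal ` S))"
    unfolding lambda_hat_def S_def Let_def by (rule refl)
  have mem: "l \<in> S" if l: "0 < l" "l < r" for l
  proof -
    \<comment> \<open>The room between \<open>l\<close> and \<open>l'\<close> pays for the factor
      \<open>C\<close> at large indices.\<close>
    define l' where "l' = (l + r) / 2"
    have l': "l < l'" "l' < r" using l by (auto simp: l'_def)
    have "eventually (\<lambda>i. l' < ln (E i) / ln (E (Suc i))) sequentially"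
      by (rule order_tendstoD(1)[OF ratio l'(2)])
    moreover have "eventually (\<lambda>i. (1 + l) * ln C / (l' - l) \<le> ln (E (Suc i))) sequentially"
      using filterlim_compose[OF lnE_top filterlim_Suc] by (simp add: filterlim_at_top)
    moreover have "eventually (\<lambda>i. (1 + \<mu>) * ln C / (1 - \<mu>) \<le> ln (E i)) sequentially"
      using lnE_top by (simp add: filterlim_at_top)
    ultimately have "eventually (\<lambda>i. l' < ln (E i) / ln (E (Suc i)) \<and>
       (1 + l) * ln C / (l' - l) \<le> ln (E (Suc i)) \<and> (1 + \<mu>) * ln C / (1 - \<mu>) \<le> ln (E i)) sequentially"
      by eventually_elim auto
    then obtain N where N: "\<And>i. N \<le> i \<Longrightarrow> l' < ln (E i) / ln (E (Suc i))"
      "\<And>i. N \<le> i \<Longrightarrow> (1 + l) * ln C / (l' - l) \<le> ln (E (Suc i))"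
      "\<And>i. N \<le> i \<Longrightarrow> (1 + \<mu>) * ln C / (1 - \<mu>) \<le> ln (E i)"
      by (auto simp: eventually_at_top_linorder)
    have "approx_sol \<xi> \<eta> X (\<lambda>x0. min (X powr (-l)) (real_of_int \<bar>x0\<bar> powr (-\<mu>)))"
      if X: "C * E N \<le> X" for X
    proof -
      define P where "P = (\<lambda>j. N \<le> j \<and> X < C * E (Suc j))"
      have "\<exists>j. P j"
      proof -
        have "eventually (\<lambda>j. X / C + 1 \<le> E j) sequentially" using E_top by (simp add: filterlim_at_top)
        then obtain M where "\<And>j. M \<le> j \<Longrightarrow> X / C + 1 \<le> E j" by (auto simp: eventually_at_top_linorder)
        then have "X / C + 1 \<le> E (Suc (max N M))" by simp
        then have "X / C < E (Suc (max N M))" by linarith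
        then have "X < C * E (Suc (max N M))" using C by (simp add: field_simps)
        then show ?thesis unfolding P_def by (metis max.cobounded1)
      qed
      define i where "i = (LEAST j. P j)"
      have "P i" unfolding i_def using \<open>\<exists>j. P j\<close> by (rule LeastI_ex)
      then have i: "N \<le> i" "X < C * E (Suc i)" by (auto simp: P_def)
      have Xi: "C * E i \<le> X"
      proof (cases "i = N")
        case False
        then obtain j where j: "i = Suc j" "N \<le> j" using i(1) by (metis le_Suc_ex add_Suc_right le_add1 add.right_neutral not0_implies_Suc)
        then have "\<not> P j" unfolding i_def by (metis i_def lessI not_less_Least)
        then show ?thesis using j by (simp add: P_def)
      qed (use X in simp)
      have pos: "0 < X" using Xi C E_pos[of i] by (meson less_le_trans mult_pos_pos zero_less_one)
      have lnE: "0 < ln (E i)" "0 < ln (E (Suc i))" using E_gt_1[of i] E_gt_1[of "Suc i"] by auto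
      have "ln X \<le> ln C + ln (E (Suc i))"
        using i(2) pos C E_pos[of "Suc i"] by (subst ln_mult_pos[symmetric]) auto
      then have "l * ln X \<le> l * (ln C + ln (E (Suc i)))" using l by (intro mult_left_mono) auto
      moreover have "l' * ln (E (Suc i)) \<le> ln (E i)"
        using N(1)[OF i(1)] lnE by (simp add: field_simps)
      moreover have "(1 + l) * ln C \<le> (l' - l) * ln (E (Suc i))"
        using N(2)[OF i(1)] l' by (simp add: field_simps)
      ultimately have "ln C - ln (E i) \<le> - l * ln X" by (simp add: algebra_simps)
      then have "exp (ln C - ln (E i)) \<le> exp (- l * ln X)" by simp
      then have 1: "C / E i \<le> X powr (-l)" using C E_pos[of i] pos by (simp add: powr_def exp_diff)
      define h where "h = real_of_int (fst (v i))"
      have h: "1 \<le> h" using v_ge_1[of i] by (simp add: h_def)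
      have "ln h \<le> ln C + ln (E i)"
        using v_le[of i] h C E_pos[of i] by (subst ln_mult_pos[symmetric]) (auto simp: h_def)
      then have "\<mu> * ln h \<le> \<mu> * (ln C + ln (E i))" using \<mu> by (intro mult_left_mono) auto
      moreover have "(1 + \<mu>) * ln C \<le> (1 - \<mu>) * ln (E i)"
        using N(3)[OF i(1)] \<mu> by (simp add: field_simps)
      ultimately have "ln C - ln (E i) \<le> - \<mu> * ln h" by (simp add: algebra_simps)
      then have "exp (ln C - ln (E i)) \<le> exp (- \<mu> * ln h)" by simp
      then have 2: "C / E i \<le> h powr (-\<mu>)" using C E_pos[of i] h by (simp add: powr_def exp_diff)
      show ?thesis unfolding approx_sol_iff
        using 1 2 v_err[of i] v_ge_1[of i] v_le[of i] Xi by (intro exI[of _ "v i"]) (auto simp: h_def)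
    qed
    then show ?thesis unfolding S_def using l by blast
  qed
  show ?thesis
  proof (rule ccontr)
    assume "\<not> ereal r \<le> lambda_hat \<mu> \<xi> \<eta>"
    then have lt: "lambda_hat \<mu> \<xi> \<eta> < ereal r" by simp
    obtain l where l: "lambda_hat \<mu> \<xi> \<eta> < ereal l" "ereal l < ereal r"
      using ereal_dense2[OF lt] by blast
    then have "0 < ereal l" using lambda_hat_nonneg by (meson le_less_trans)
    then have "l \<in> S" using l mem[of l] by (simp add: zero_ereal_def)
    then have "ereal l \<le> lambda_hat \<mu> \<xi> \<eta>" unfolding hat by (auto intro: Sup_upper)
    with l show False by simp
  qed
qed

text \<open>Test with \<open>X\<close> just below the reach of \<open>v (Suc i)\<close>. Points of
  the second kind then have error at least \<open>c / E i\<close>, which is too large if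
  \<open>l > r\<close>; points of the first kind have bounded height because
  \<open>\<theta> < \<mu>\<close>, so their error is bounded below.\<close>

lemma lambda_hat_le:
  assumes \<mu>: "\<theta> < \<mu>" "\<mu> < 1"
  shows "lambda_hat \<mu> \<xi> \<eta> \<le> ereal r"
proof -
  have "l \<le> r" if "0 < l" and "\<exists>X0. \<forall>X\<ge>X0. approx_sol \<xi> \<eta> X
                  (\<lambda>x0. min (X powr (-l)) (real_of_int \<bar>x0\<bar> powr (-\<mu>)))" for l
  proof (rule ccontr)
    assume lr: "\<not> l \<le> r"
    from that obtain X0 where X0: "\<And>X. X0 \<le> X \<Longrightarrow> approx_sol \<xi> \<eta> X
                  (\<lambda>x0. min (X powr (-l)) (real_of_int \<bar>x0\<bar> powr (-\<mu>)))" by blast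
    \<comment> \<open>\<open>K\<close> is the largest height compatible with both
      \<open>c * h powr (-\<theta>) \<le> err\<close> and
      \<open>err \<le> h powr (-\<mu>)\<close>.\<close>
    define K where "K = max 1 ((1 / c) powr (1 / (\<mu> - \<theta>)))"
    have K: "1 \<le> K" by (simp add: K_def)
    have "0 < c * K powr (-\<theta>)" using c K by simp
    from eventually_powr_neg_less[OF \<open>0 < l\<close> this] obtain X1
      where X1: "\<And>X. X1 \<le> X \<Longrightarrow> X powr (-l) < c * K powr (-\<theta>)"
      by (auto simp: eventually_at_top_linorder)
    define l' where "l' = (l + r) / 2"
    have l': "l' < l" "r < l'" using lr by (auto simp: l'_def)
    define B where "B = max (max X0 X1) 1 / (c / 2)"
    have "eventually (\<lambda>i. ln (E i) / ln (E (Suc i)) < l') sequentially"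
      by (rule order_tendstoD(2)[OF ratio l'(2)])
    moreover have "eventually (\<lambda>i. (- ln c - l * ln (c / 2)) / (l - l') + 1 \<le> ln (E (Suc i))) sequentially"
      using filterlim_compose[OF lnE_top filterlim_Suc] by (simp add: filterlim_at_top)
    moreover have "eventually (\<lambda>i. B \<le> E (Suc i)) sequentially"
      using filterlim_compose[OF E_top filterlim_Suc] by (simp add: filterlim_at_top)
    ultimately have "eventually (\<lambda>i. ln (E i) / ln (E (Suc i)) < l' \<and>
       (- ln c - l * ln (c / 2)) / (l - l') + 1 \<le> ln (E (Suc i)) \<and> B \<le> E (Suc i)) sequentially"
      by eventually_elim auto
    from eventually_happens'[OF sequentially_bot this]
    obtain i where i: "ln (E i) / ln (E (Suc i)) < l'"
       "(- ln c - l * ln (c / 2)) / (l - l') + 1 \<le> ln (E (Suc i))" "B \<le> E (Suc i)"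
      by auto
    \<comment> \<open>The factor \<open>c / 2\<close> excludes \<open>c * E j \<le> X\<close> for
      every \<open>j > i\<close>.\<close>
    define X where "X = c / 2 * E (Suc i)"
    have X: "X0 \<le> X" "X1 \<le> X" "1 \<le> X" using i(3) c by (auto simp: X_def B_def field_simps)
    obtain w where w: "1 \<le> \<bar>fst w\<bar>" "real_of_int \<bar>fst w\<bar> \<le> X"
        "err \<xi> \<eta> w \<le> X powr (-l)" "err \<xi> \<eta> w \<le> real_of_int \<bar>fst w\<bar> powr (-\<mu>)"
      using X0[OF X(1)] unfolding approx_sol_iff by auto
    define h where "h = real_of_int \<bar>fst w\<bar>"
    have h: "1 \<le> h" using w by (simp add: h_def)
    from dichotomy[OF w(1)] show False
    proof
      assume "c * real_of_int \<bar>fst w\<bar> powr (-\<theta>) \<le> err \<xi> \<eta> w"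
      then have e: "c * h powr (-\<theta>) \<le> err \<xi> \<eta> w" by (simp add: h_def)
      then have "c * h powr (-\<theta>) \<le> h powr (-\<mu>)" using w by (simp add: h_def)
      then have "c * h powr (-\<theta>) * h powr \<mu> \<le> h powr (-\<mu>) * h powr \<mu>" by (intro mult_right_mono) auto
      then have "c * h powr (\<mu> - \<theta>) \<le> 1" using h by (simp add: mult.assoc flip: powr_add)
      then have "h powr (\<mu> - \<theta>) \<le> 1 / c" using c by (simp add: field_simps)
      then have "(h powr (\<mu> - \<theta>)) powr (1 / (\<mu> - \<theta>)) \<le> (1 / c) powr (1 / (\<mu> - \<theta>))"
        using \<mu> by (intro powr_mono2) auto
      then have "h \<le> K" using \<mu> h by (simp add: powr_powr K_def)
      then have "K powr (-\<theta>) \<le> h powr (-\<theta>)" using h \<theta> by (intro powr_mono2') auto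
      then have "c * K powr (-\<theta>) \<le> c * h powr (-\<theta>)" using c by simp
      with e w(3) X1[OF X(2)] show False by linarith
    next
      assume "\<exists>j. c * E j \<le> real_of_int \<bar>fst w\<bar> \<and> c / E j \<le> err \<xi> \<eta> w"
      then obtain j where j: "c * E j \<le> h" "c / E j \<le> err \<xi> \<eta> w" by (auto simp: h_def)
      have "c * E j \<le> c / 2 * E (Suc i)" using j(1) w(2) by (simp add: h_def X_def)
      also have "\<dots> < c * E (Suc i)" using c E_pos[of "Suc i"] by simp
      finally have "E j < E (Suc i)" using c by simp
      then have "j \<le> i" using E_mono by (simp add: strict_mono_less less_Suc_eq_le)
      then have "E j \<le> E i" using E_mono by (simp add: strict_mono_less_eq)
      then have "c / E i \<le> c / E j" using c E_pos by (intro divide_left_mono) auto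
      then have "c / E i \<le> X powr (-l)" using j(2) w(3) by linarith
      then have "ln (c / E i) \<le> ln (X powr (-l))" using c E_pos[of i] X by (intro ln_mono) auto
      then have "ln c - ln (E i) \<le> - l * ln X" using c E_pos[of i] X by (simp add: ln_div ln_powr)
      also have "ln X = ln (c / 2) + ln (E (Suc i))"
        using c E_pos[of "Suc i"] unfolding X_def by (subst ln_mult_pos) auto
      finally have a: "l * ln (E (Suc i)) \<le> ln (E i) - ln c - l * ln (c / 2)" by (simp add: algebra_simps)
      have "ln (E i) < l' * ln (E (Suc i))" using i(1) E_gt_1[of "Suc i"] by (simp add: field_simps)
      then have "(l - l') * ln (E (Suc i)) < - ln c - l * ln (c / 2)" using a by (simp add: algebra_simps)
      then have "ln (E (Suc i)) < (- ln c - l * ln (c / 2)) / (l - l')" using l' by (simp add: field_simps)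
      with i(2) show False by linarith
    qed
  qed
  then have "\<And>l. l \<in> {l. 0 < l \<and> (\<exists>X0. \<forall>X\<ge>X0. approx_sol \<xi> \<eta> X
      (\<lambda>x0. min (X powr (-l)) (real_of_int \<bar>x0\<bar> powr (-\<mu>))))} \<Longrightarrow> l \<le> r"
    by blast
  then show ?thesis using r_nonneg by (rule lambda_hat_le_of_bound)
qed

lemma lambda_min_eq: "lambda_min \<xi> \<eta> = ereal r"
proof (rule antisym)
  define \<mu> where "\<mu> = (\<theta> + 1) / 2"
  have "lambda_min \<xi> \<eta> \<le> lambda_hat \<mu> \<xi> \<eta>"
    unfolding lambda_min_def lambda_exp_eq_1 by (rule INF_lower) (use \<theta> in \<open>auto simp: \<mu>_def one_ereal_def\<close>)
  also have "\<dots> \<le> ereal r" by (rule lambda_hat_le) (use \<theta> in \<open>auto simp: \<mu>_def\<close>)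
  finally show "lambda_min \<xi> \<eta> \<le> ereal r" .
  show "ereal r \<le> lambda_min \<xi> \<eta>"
    unfolding lambda_min_def lambda_exp_eq_1
    by (rule INF_greatest, rule lambda_hat_ge) (auto simp: one_ereal_def)
qed

end

subsection \<open>Best approximations and the golden ratio\<close>

text \<open>Rounding minimizes the error among points with first coordinate \<open>a\<close> or
  \<open>- a\<close>, so best approximations can be sought among natural numbers.\<close>

definition best_err :: "real \<Rightarrow> real \<Rightarrow> nat \<Rightarrow> real" where
  "best_err \<xi> \<eta> a = err \<xi> \<eta> (int a, round (real a * \<xi>), round (real a * \<eta>))"

lemma best_err_le: "best_err \<xi> \<eta> (nat \<bar>fst w\<bar>) \<le> err \<xi> \<eta> w"
proof -
  obtain w0 w1 w2 where w: "w = (w0, w1, w2)" by (metis prod_cases3)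
  have *: "\<bar>real_of_int \<bar>w0\<bar> * x - round (real_of_int \<bar>w0\<bar> * x)\<bar> \<le> \<bar>real_of_int w0 * x - real_of_int y\<bar>" for x y
  proof (cases "0 \<le> w0")
    case True
    then show ?thesis using round_diff_minimal[of "w0 * x" y] by simp
  next
    case False
    then show ?thesis using round_diff_minimal[of "- (w0 * x)" "- y"] by (simp add: abs_minus_commute)
  qed
  show ?thesis unfolding best_err_def w err_def using *[of \<xi> w1] *[of \<eta> w2]
    by (simp add: max.coboundedI1 max.coboundedI2)
qed

lemma best_err_pos:
  assumes "Q_lin_indep3 \<xi> \<eta>" "1 \<le> a"
  shows "0 < best_err \<xi> \<eta> a"
proof (rule ccontr)
  assume "\<not> 0 < best_err \<xi> \<eta> a"
  then have "real_of_int (- round (real a * \<xi>)) + real_of_int (int a) * \<xi> + real_of_int 0 * \<eta> = 0"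
    by (auto simp: best_err_def err_def max_def split: if_splits)
  from Q_lin_indep3_intD[OF assms(1) this] assms(2) show False by simp
qed

lemma lambda_hat_le_golden:
  assumes ind: "Q_lin_indep3 \<xi> \<eta>" and exp1: "lambda_exp \<xi> \<eta> = 1"
  shows "lambda_hat \<mu> \<xi> \<eta> \<le> ereal ((sqrt 5 - 1) / 2)"
proof -
  define \<phi> :: real where "\<phi> = (sqrt 5 - 1) / 2"
  have \<phi>: "0 < \<phi>" "\<phi> < 1" "\<phi>\<^sup>2 = 1 - \<phi>"
  proof -
    have "(1::real) < sqrt 5" "sqrt 5 < (3::real)" by (auto intro: real_less_rsqrt real_less_lsqrt)
    then show "0 < \<phi>" "\<phi> < 1" by (auto simp: \<phi>_def)
    show "\<phi>\<^sup>2 = 1 - \<phi>" by (simp add: \<phi>_def power2_eq_square field_simps)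
  qed
  have "l0 \<le> \<phi>" if l0: "0 < l0" and ex0: "\<exists>X0. \<forall>X\<ge>X0. approx_sol \<xi> \<eta> X
                  (\<lambda>x0. min (X powr (-l0)) (real_of_int \<bar>x0\<bar> powr (-\<mu>)))" for l0
  proof (rule ccontr)
    assume "\<not> l0 \<le> \<phi>"
    \<comment> \<open>Uniform exponents may be lowered; keeping \<open>l\<close> below 1 makes
      \<open>1 - l\<close> a positive exponent later.\<close>
    define l where "l = min l0 ((\<phi> + 1) / 2)"
    have l: "\<phi> < l" "l < 1" "l \<le> l0" "0 < l" using \<phi> \<open>\<not> l0 \<le> \<phi>\<close> by (auto simp: l_def min_def)
    \<comment> \<open>As \<open>\<phi>\<^sup>2 = 1 - \<phi>\<close>, any \<open>l > \<phi>\<close>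
      has \<open>l\<^sup>2 > 1 - l\<close>. Half of this excess leaves room for some
      \<open>l' > 1\<close> with \<open>l' * (1 - l) < l\<^sup>2\<close>, and ordinary exponent 1
      forbids errors below \<open>a powr (- l')\<close> for large \<open>a\<close>.\<close>
    define l' where "l' = min 2 (1 + (l\<^sup>2 - (1 - l)) / 2)"
    have l2: "1 - l < l\<^sup>2"
      using l \<phi> power_strict_mono[of \<phi> l 2] by simp
    have l': "1 < l'" "l' * (1 - l) < l\<^sup>2"
    proof -
      show "1 < l'" using l2 by (simp add: l'_def)
      have "l' * (1 - l) \<le> (1 + (l\<^sup>2 - (1 - l)) / 2) * (1 - l)"
        using l by (intro mult_right_mono) (auto simp: l'_def)
      also have "\<dots> = (1 - l) + (l\<^sup>2 - (1 - l)) / 2 * (1 - l)" by (simp add: algebra_simps)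
      also have "(l\<^sup>2 - (1 - l)) / 2 * (1 - l) \<le> (l\<^sup>2 - (1 - l)) / 2 * 1"
        using l l2 by (intro mult_left_mono) auto
      also have "(1 - l) + (l\<^sup>2 - (1 - l)) / 2 * 1 < (1 - l) + (l\<^sup>2 - (1 - l)) * 1"
        unfolding mult_1_right using l2 by argo
      finally show "l' * (1 - l) < l\<^sup>2" by simp
    qed
    define d where "d = best_err \<xi> \<eta>"
    have d_pos: "0 < d a" if "1 \<le> a" for a using best_err_pos[OF ind that] by (simp add: d_def)
    from ex0 obtain X0 where X0: "\<And>X. X0 \<le> X \<Longrightarrow> approx_sol \<xi> \<eta> X
                  (\<lambda>x0. min (X powr (-l0)) (real_of_int \<bar>x0\<bar> powr (-\<mu>)))" by blast
    have ex: "\<exists>a. 1 \<le> a \<and> real a \<le> X \<and> d a \<le> X powr (-l)" if "max 1 X0 \<le> X" for X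
    proof -
      obtain w where w: "1 \<le> \<bar>fst w\<bar>" "real_of_int \<bar>fst w\<bar> \<le> X" "err \<xi> \<eta> w \<le> X powr (-l0)"
        using X0[of X] \<open>max 1 X0 \<le> X\<close> unfolding approx_sol_iff by auto
      have "X powr (-l0) \<le> X powr (-l)" using that l by (intro powr_mono) auto
      then show ?thesis using w best_err_le[of \<xi> \<eta> w]
        by (intro exI[of _ "nat \<bar>fst w\<bar>"]) (auto simp: d_def)
    qed
    have "\<not> (\<forall>X0. \<exists>X\<ge>X0. approx_sol \<xi> \<eta> X (\<lambda>_. X powr - l'))"
    proof
      assume "\<forall>X0. \<exists>X\<ge>X0. approx_sol \<xi> \<eta> X (\<lambda>_. X powr - l')"
      then have "ereal l' \<le> lambda_exp \<xi> \<eta>" unfolding lambda_exp_def using l' by (intro Sup_upper imageI) auto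
      with exp1 l' show False by (simp add: one_ereal_def)
    qed
    then obtain X1 where X1: "\<And>X. X1 \<le> X \<Longrightarrow> \<not> approx_sol \<xi> \<eta> X (\<lambda>_. X powr - l')" by blast
    have d_low: "real a powr (-l') \<le> d a" if a: "1 \<le> a" "X1 \<le> real a" for a
    proof (rule ccontr)
      assume "\<not> real a powr (-l') \<le> d a"
      then have "approx_sol \<xi> \<eta> (real a) (\<lambda>_. real a powr - l')"
        unfolding approx_sol_iff using a
        by (intro exI[of _ "(int a, round (real a * \<xi>), round (real a * \<eta>))"]) (auto simp: d_def best_err_def)
      with X1[OF a(2)] show False by simp
    qed
    define nxt where "nxt = (\<lambda>a. LEAST b. 1 \<le> b \<and> d b < d a)"
    have nxt: "1 \<le> nxt a \<and> d (nxt a) < d a" if a: "1 \<le> a" for a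
    proof -
      from eventually_powr_neg_less[OF l(4) d_pos[OF a]] obtain X2 where X2: "\<And>X. X2 \<le> X \<Longrightarrow> X powr (-l) < d a"
        by (auto simp: eventually_at_top_linorder)
      obtain b where "1 \<le> b" "d b \<le> (max (max 1 X0) X2) powr (-l)" using ex[of "max (max 1 X0) X2"] by auto
      then have "1 \<le> b \<and> d b < d a" using X2[of "max (max 1 X0) X2"] by auto
      then show ?thesis unfolding nxt_def by (rule LeastI)
    qed
    have nxt_least: "d a \<le> d b" if "1 \<le> b" "b < nxt a" for a b
      using that not_less_Least[of b "\<lambda>b. 1 \<le> b \<and> d b < d a"] unfolding nxt_def by fastforce
    define a where "a = rec_nat 1 (\<lambda>_. nxt)"
    have a_Suc: "a (Suc i) = nxt (a i)" for i by (simp add: a_def)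
    have a1: "1 \<le> a i" for i by (induction i) (use nxt in \<open>auto simp: a_def\<close>)
    have d_dec: "d (a (Suc i)) < d (a i)" for i using nxt[OF a1[of i]] by (simp add: a_Suc)
    \<comment> \<open>If \<open>a (Suc i)\<close> came before \<open>a i = nxt (a j)\<close>, it
      would have smaller error than \<open>a j\<close>, against the minimality of
      \<open>nxt (a j)\<close>.\<close>
    have a_less: "a i < a (Suc i)" for i
    proof (cases i)
      case 0
      have "a 1 \<noteq> 1" using d_dec[of 0] by (auto simp: a_def)
      then show ?thesis using 0 a1[of 1] by (simp add: a_def)
    next
      case (Suc j)
      show ?thesis
      proof (rule ccontr)
        assume "\<not> a i < a (Suc i)"
        moreover have "a (Suc i) \<noteq> a i" using d_dec[of i] by auto
        ultimately have "a (Suc i) < nxt (a j)" using Suc by (simp add: a_Suc)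
        then have "d (a j) \<le> d (a (Suc i))" using a1 nxt_least by blast
        then show False using d_dec[of i] d_dec[of j] Suc by simp
      qed
    qed
    have a_mono: "strict_mono a" using a_less by (simp add: strict_mono_Suc_iff)
    then have a_ge: "i \<le> a i" for i by (rule strict_mono_imp_increasing)
    define p where "p = (\<lambda>i. (int (a i), round (real (a i) * \<xi>), round (real (a i) * \<eta>)))"
    have p: "fst (p i) = int (a i)" "err \<xi> \<eta> (p i) = d (a i)" for i
      by (auto simp: p_def d_def best_err_def)
    \<comment> \<open>Uniform approximation is applied at half of \<open>a (Suc i)\<close>: the
      point found lies strictly before the next best approximation, so it cannot beat
      \<open>a i\<close>.\<close>
    have d_up: "d (a i) \<le> 2 * real (a (Suc i)) powr (-l)" if "2 * max 1 X0 \<le> real (a (Suc i))" for i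
    proof -
      define N where "N = real (a (Suc i))"
      have N: "1 \<le> N / 2" "X0 \<le> N / 2" using that by (auto simp: N_def)
      obtain b where b: "1 \<le> b" "real b \<le> N / 2" "d b \<le> (N / 2) powr (-l)"
        using ex[of "N / 2"] N max.boundedI[OF N] by blast
      have "b < a (Suc i)" using b(2) N unfolding N_def by linarith
      then have "d (a i) \<le> d b" using nxt_least[of b "a i"] b(1) by (simp add: a_Suc)
      also note b(3)
      also have "(N / 2) powr (-l) = 2 powr l * N powr (-l)" using N by (simp add: powr_divide powr_minus field_simps)
      also have "2 powr l * N powr (-l) \<le> 2 * N powr (-l)"
        using powr_mono[of l 1 2] l by (intro mult_right_mono) auto
      finally show ?thesis by (simp add: N_def)
    qed
    \<comment> \<open>Otherwise all points from index \<open>n\<close> on lie in one rational plane,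
      and the equation of that plane passes to the limit as a rational relation between 1,
      \<open>\<xi>\<close> and \<open>\<eta>\<close>.\<close>
    have indep: "\<exists>i\<ge>n. det3 (p i) (p (Suc i)) (p (Suc (Suc i))) \<noteq> 0" for n
    proof (rule ccontr)
      assume "\<not> ?thesis"
      then have z: "det3 (p i) (p (Suc i)) (p (Suc (Suc i))) = 0" if "n \<le> i" for i using that by blast
      \<comment> \<open>The cross product of consecutive points. It cannot vanish: proportional
        points have errors proportional to their heights, whereas here heights increase and errors
        decrease.\<close>
      define cr where "cr = (\<lambda>i. case p i of (x0, x1, x2) \<Rightarrow> case p (Suc i) of (y0, y1, y2) \<Rightarrow>
         (x1 * y2 - x2 * y1, x2 * y0 - x0 * y2, x0 * y1 - x1 * y0))"
      have cr: "cr i \<noteq> (0, 0, 0)" for i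
      proof
        assume c0: "cr i = (0, 0, 0)"
        have scale: "real (a (Suc i)) * \<bar>real (a i) * x - round (real (a i) * x)\<bar>
             = real (a i) * \<bar>real (a (Suc i)) * x - round (real (a (Suc i)) * x)\<bar>"
          if "int (a i) * round (real (a (Suc i)) * x) = round (real (a i) * x) * int (a (Suc i))" for x
        proof -
          have "real (a i) * round (real (a (Suc i)) * x) = real (a (Suc i)) * round (real (a i) * x)"
            using arg_cong[OF that, of real_of_int] by (simp add: mult.commute)
          then have "real (a (Suc i)) * (real (a i) * x - round (real (a i) * x))
             = real (a i) * (real (a (Suc i)) * x - round (real (a (Suc i)) * x))"
            by (simp add: algebra_simps)
          then show ?thesis by (metis abs_mult abs_of_nat)
        qed
        have "real (a (Suc i)) * d (a i) = real (a i) * d (a (Suc i))"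
          using c0 scale[of \<xi>] scale[of \<eta>]
          by (simp add: cr_def p_def d_def best_err_def err_def max_mult_distrib_left mult.commute)
        moreover have "real (a i) * d (a (Suc i)) \<le> real (a (Suc i)) * d (a (Suc i))"
          using a_less[of i] d_pos[OF a1[of "Suc i"]] by (intro mult_right_mono) auto
        moreover have "real (a (Suc i)) * d (a (Suc i)) < real (a (Suc i)) * d (a i)"
          using d_dec[of i] a1[of "Suc i"] by (intro mult_strict_left_mono) auto
        ultimately show False by linarith
      qed
      obtain A B C where ABC: "cr n = (A, B, C)" by (metis prod_cases3)
      define dot where "dot = (\<lambda>i. case p i of (x0, x1, x2) \<Rightarrow> A * x0 + B * x1 + C * x2)"
      have dot: "dot (n + j) = 0 \<and> dot (Suc (n + j)) = 0" for j
      proof (induction j)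
        case 0
        obtain x0 x1 x2 y0 y1 y2 where e: "p n = (x0, x1, x2)" "p (Suc n) = (y0, y1, y2)" by (metis prod_cases3)
        then have *: "A = x1 * y2 - x2 * y1" "B = x2 * y0 - x0 * y2" "C = x0 * y1 - x1 * y0"
          using ABC by (auto simp: cr_def)
        have "A * x0 + B * x1 + C * x2 = 0" "A * y0 + B * y1 + C * y2 = 0"
          unfolding * by (simp_all add: algebra_simps)
        then show ?case using e by (simp add: dot_def)
      next
        case (Suc j)
        obtain x0 x1 x2 y0 y1 y2 z0 z1 z2 where e: "p (n + j) = (x0, x1, x2)" "p (Suc (n + j)) = (y0, y1, y2)"
          "p (Suc (Suc (n + j))) = (z0, z1, z2)" by (metis prod_cases3)
        have d0: "x0 * (y1 * z2 - y2 * z1) - y0 * (x1 * z2 - x2 * z1) + z0 * (x1 * y2 - x2 * y1) = 0"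
          using z[of "n + j"] e by simp
        have xy: "A * x0 + B * x1 + C * x2 = 0" "A * y0 + B * y1 + C * y2 = 0" using Suc e by (auto simp: dot_def)
        define k0 k1 k2 where "k0 = x1 * y2 - x2 * y1" and "k1 = x2 * y0 - x0 * y2" and "k2 = x0 * y1 - x1 * y0"
        have "k0 * (A * z0 + B * z1 + C * z2) = 0" "k1 * (A * z0 + B * z1 + C * z2) = 0" "k2 * (A * z0 + B * z1 + C * z2) = 0"
          using d0 xy unfolding k0_def k1_def k2_def by algebra+
        moreover have "k0 \<noteq> 0 \<or> k1 \<noteq> 0 \<or> k2 \<noteq> 0" using cr[of "n + j"] e by (auto simp: cr_def k0_def k1_def k2_def)
        ultimately show ?case using Suc e by (auto simp: dot_def)
      qed
      define \<Lambda> where "\<Lambda> = real_of_int A + real_of_int B * \<xi> + real_of_int C * \<eta>"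
      have "real j * \<bar>\<Lambda>\<bar> \<le> (\<bar>real_of_int B\<bar> + \<bar>real_of_int C\<bar>) * d (a 0)" for j
      proof -
        have "real j * \<bar>\<Lambda>\<bar> \<le> real (a (n + j)) * \<bar>\<Lambda>\<bar>" using a_ge[of "n + j"] by (intro mult_right_mono) auto
        also have "\<dots> \<le> (\<bar>real_of_int B\<bar> + \<bar>real_of_int C\<bar>) * d (a (n + j))"
        proof -
          obtain x0 x1 x2 where e: "p (n + j) = (x0, x1, x2)" by (metis prod_cases3)
          have "x0 = int (a (n + j))" "err \<xi> \<eta> (x0, x1, x2) = d (a (n + j))" using p[of "n + j"] e by auto
          moreover have "A * x0 + B * x1 + C * x2 = 0" using dot[of j] e by (simp add: dot_def)
          ultimately show ?thesis using abs_linear_form_le[of A x0 B x1 C x2 \<xi> \<eta>]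
            by (simp add: \<Lambda>_def abs_mult del: of_int_add of_int_mult)
        qed
        also have "\<dots> \<le> (\<bar>real_of_int B\<bar> + \<bar>real_of_int C\<bar>) * d (a 0)"
          using lift_Suc_antimono_le[of "\<lambda>i. d (a i)" 0 "n + j"] d_dec by (intro mult_left_mono) (auto simp: less_imp_le)
        finally show ?thesis .
      qed
      then have "\<Lambda> = 0" by (metis abs_le_zero_iff abs_ge_zero antisym_conv real_archimedian_rdiv_eq_0 mult.commute order_refl abs_eq_0 d_pos a1 less_imp_le mult_nonneg_nonneg add_nonneg_nonneg)
      then have "cr n = (0, 0, 0)" using Q_lin_indep3_intD[OF ind, of A B C] ABC by (simp add: \<Lambda>_def)
      with cr show False by blast
    qed
    define e where "e = l\<^sup>2 - l' * (1 - l)"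
    have e: "0 < e" using l' by (simp add: e_def)
    have "eventually (\<lambda>X. X powr (-e) < 1 / (24 powr l * (2 powr (1 - l)))) at_top" by (rule eventually_powr_neg_less[OF e]) auto
    then obtain X2 where X2: "\<And>X. X2 \<le> X \<Longrightarrow> X powr (-e) < 1 / (24 powr l * (2 powr (1 - l)))"
      by (auto simp: eventually_at_top_linorder)
    obtain n :: nat where n: "max (max (2 * max 1 X0) X1) X2 \<le> real n" using real_arch_simple by blast
    obtain i where i: "n \<le> i" "det3 (p i) (p (Suc i)) (p (Suc (Suc i))) \<noteq> 0" using indep by blast
    define P Q R where "P = real (a i)" and "Q = real (a (Suc i))" and "R = real (a (Suc (Suc i)))"
    have big: "real n \<le> Q" using a_ge[of "Suc i"] i(1) unfolding P_def Q_def R_def by linarith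
    have PQR: "P < Q" "Q < R" "1 \<le> P" using a_less[of i] a_less[of "Suc i"] a1[of i] by (auto simp: P_def Q_def R_def)
    define d0 d1 d2 where "d0 = d (a i)" and "d1 = d (a (Suc i))" and "d2 = d (a (Suc (Suc i)))"
    have dd: "0 < d2" "d2 < d1" "d1 < d0" using d_dec d_pos[OF a1] by (auto simp: d0_def d1_def d2_def)
    have u0: "d0 \<le> 2 * Q powr (-l)" and u1: "d1 \<le> 2 * R powr (-l)"
      using d_up[of i] d_up[of "Suc i"] n big PQR by (auto simp: P_def Q_def R_def d0_def d1_def d2_def)
    have low: "Q powr (-l') \<le> d1" using d_low[OF a1[of "Suc i"]] n big by (auto simp: P_def Q_def R_def d0_def d1_def d2_def)
    have "1 \<le> \<bar>real_of_int (det3 (p i) (p (Suc i)) (p (Suc (Suc i))))\<bar>" using i(2) by linarith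
    also have "\<dots> \<le> 2 * (P * d1 * d2 + Q * d0 * d2 + R * d0 * d1)"
      using det3_bound[of "p i" "p (Suc i)" "p (Suc (Suc i))" \<xi> \<eta>] by (simp add: p P_def Q_def R_def d0_def d1_def d2_def)
    also have "P * d1 * d2 \<le> R * d0 * d1" using PQR dd by (intro order_trans[of "P * d1 * d2" "R * d1 * d0" "R * d0 * d1"] mult_mono) auto
    also have "Q * d0 * d2 \<le> R * d0 * d1" using PQR dd by (intro mult_mono) auto
    finally have "1 \<le> 6 * (R * d0 * d1)" by simp
    also have "\<dots> \<le> 6 * (R * (2 * Q powr (-l)) * (2 * R powr (-l)))"
      using u0 u1 PQR dd by (intro mult_left_mono mult_mono) auto
    also have "\<dots> = 24 * (R powr (1 - l) * Q powr (-l))"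
      using PQR powr_add[of R 1 "-l"] by simp
    finally have "Q powr l * 1 \<le> Q powr l * (24 * (R powr (1 - l) * Q powr (-l)))" by (intro mult_left_mono) auto
    also have "\<dots> = 24 * R powr (1 - l)" using PQR powr_add[of Q l "-l"] by simp
    finally have "Q powr l \<le> 24 * R powr (1 - l)" by simp
    \<comment> \<open>After raising to the power \<open>l\<close>, the number \<open>R\<close>
      enters only through \<open>R powr l\<close>, which \<open>low\<close> and \<open>u1\<close>
      bound by \<open>2 * Q powr l'\<close>. What remains is an inequality in \<open>Q\<close>
      alone, false for large \<open>Q\<close>.\<close>
    then have "(Q powr l) powr l \<le> (24 * R powr (1 - l)) powr l" using l by (intro powr_mono2) auto
    then have s1: "Q powr (l\<^sup>2) \<le> 24 powr l * (R powr l) powr (1 - l)"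
      by (simp add: powr_powr powr_mult power2_eq_square mult.commute)
    have "Q powr (-l') \<le> 2 * R powr (-l)" using low u1 by linarith
    then have "R powr l \<le> 2 * Q powr l'" using PQR by (simp add: powr_minus field_simps)
    then have "(R powr l) powr (1 - l) \<le> (2 * Q powr l') powr (1 - l)" using l by (intro powr_mono2) auto
    also have "\<dots> = 2 powr (1 - l) * Q powr (l' * (1 - l))" by (simp add: powr_mult powr_powr)
    finally have "24 powr l * (R powr l) powr (1 - l) \<le> 24 powr l * (2 powr (1 - l) * Q powr (l' * (1 - l)))"
      by (intro mult_left_mono) auto
    with s1 have "Q powr (l\<^sup>2) \<le> (24 powr l * 2 powr (1 - l)) * Q powr (l' * (1 - l))"
      unfolding mult.assoc by (rule order_trans)
    moreover have "Q powr (l' * (1 - l)) = Q powr (l\<^sup>2) * Q powr (-e)"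
      by (simp add: e_def flip: powr_add)
    ultimately have "Q powr (l\<^sup>2) * 1 \<le> Q powr (l\<^sup>2) * ((24 powr l * 2 powr (1 - l)) * Q powr (-e))"
      by (simp add: mult_ac)
    then have "1 \<le> (24 powr l * 2 powr (1 - l)) * Q powr (-e)"
      using PQR by (subst (asm) mult_le_cancel_left_pos) auto
    then have "1 / (24 powr l * 2 powr (1 - l)) \<le> Q powr (-e)" by (simp add: field_simps)
    with X2[of Q] n big show False by simp
  qed
  then have "\<And>l. l \<in> {l. 0 < l \<and> (\<exists>X0. \<forall>X\<ge>X0. approx_sol \<xi> \<eta> X
      (\<lambda>x0. min (X powr (-l)) (real_of_int \<bar>x0\<bar> powr (-\<mu>))))} \<Longrightarrow> l \<le> \<phi>"
    by blast
  then show ?thesis using \<phi>(1) unfolding \<phi>_def[symmetric] by (intro lambda_hat_le_of_bound) auto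
qed

lemma recip_lambda_min_ge:
  assumes "(\<xi>, \<eta>) \<in> V_set"
  shows "ereal ((1 + sqrt 5) / 2) \<le> recip_inf (lambda_min \<xi> \<eta>)"
proof -
  have V: "Q_lin_indep3 \<xi> \<eta>" "lambda_exp \<xi> \<eta> = 1" using assms by (auto simp: V_set_def)
  have "lambda_min \<xi> \<eta> \<le> lambda_hat (1 / 2) \<xi> \<eta>"
    unfolding lambda_min_def V(2) by (rule INF_lower) (auto simp: one_ereal_def)
  also note lambda_hat_le_golden[OF V]
  finally have le: "lambda_min \<xi> \<eta> \<le> ereal ((sqrt 5 - 1) / 2)" .
  have ge: "0 \<le> lambda_min \<xi> \<eta>"
    unfolding lambda_min_def by (rule INF_greatest) (rule lambda_hat_nonneg)
  obtain m where m: "lambda_min \<xi> \<eta> = ereal m" "0 \<le> m" "m \<le> (sqrt 5 - 1) / 2"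
    using le ge by (cases "lambda_min \<xi> \<eta>") auto
  show ?thesis
  proof (cases "m = 0")
    case True then show ?thesis by (simp add: recip_inf_def m zero_ereal_def)
  next
    case False
    have "(1 + sqrt 5) / 2 * m \<le> (1 + sqrt 5) / 2 * ((sqrt 5 - 1) / 2)" using m by (intro mult_left_mono) auto
    also have "\<dots> = 1" by (simp add: field_simps)
    finally have "(1 + sqrt 5) / 2 \<le> 1 / m" using False m by (simp add: field_simps)
    then show ?thesis using False m by (simp add: recip_inf_def one_ereal_def)
  qed
qed

subsection \<open>Prescribing the exponents\<close>

text \<open>A fixed factor \<open>\<kappa>\<close> every three steps outgrows any linear function,
  and rescaling by \<open>A\<close> turns it into the additive surplus required by
  \<open>growth\<close>. The constant 6 instead of 5 survives rounding down.\<close>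

lemma linear_growth:
  fixes f :: "nat \<Rightarrow> real"
  assumes pos: "\<And>n. 0 < f n" and \<kappa>: "1 < \<kappa>" and f3: "\<And>n. \<kappa> * f n \<le> f (n + 3)"
  obtains A where "0 < A" "\<And>n. real n + 6 \<le> A * f n" "\<And>n. A * f n + real n + 6 \<le> A * f (n + 3)"
proof -
  define m where "m = min (f 0) (min (f 1) (f 2))"
  \<comment> \<open>The first bound covers the indices 0, 1, 2, where
    \<open>real n + 6 \<le> 8\<close>; the second covers the induction step by 3.\<close>
  define \<epsilon> where "\<epsilon> = min (m / 8) ((\<kappa> - 1) * m / 3)"
  have m: "0 < m" "m \<le> f 0" "m \<le> f 1" "m \<le> f 2" using pos by (auto simp: m_def)
  have \<epsilon>: "0 < \<epsilon>" "8 * \<epsilon> \<le> m" "3 * \<epsilon> \<le> (\<kappa> - 1) * m" using m \<kappa> by (auto simp: \<epsilon>_def min_def field_simps)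
  have *: "\<epsilon> * (real n + 6) \<le> f n \<and> m \<le> f n" for n
  proof (induction n rule: less_induct)
    case (less n)
    consider "n = 0" | "n = 1" | "n = 2" | j where "n = j + 3"
      by (metis One_nat_def add_2_eq_Suc' add.commute less_2_cases not_less le_Suc_ex numeral_3_eq_3 numeral_2_eq_2 not_less_eq less_Suc_eq)
    then show ?case
    proof cases
      case (4 j)
      have IH: "\<epsilon> * (real j + 6) \<le> f j" "m \<le> f j" using less.IH[of j] 4 by auto
      have "(\<kappa> - 1) * m \<le> (\<kappa> - 1) * f j" using IH \<kappa> by (intro mult_left_mono) auto
      then have "f j + 3 * \<epsilon> \<le> f n" using f3[of j] \<epsilon> 4 by (simp add: algebra_simps)
      then show ?thesis using IH \<epsilon> 4 by (simp add: algebra_simps)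
    qed (use m \<epsilon> in auto)
  qed
  define A where "A = max (1 / \<epsilon>) (1 / (\<epsilon> * (\<kappa> - 1)))"
  have A: "0 < A" "1 \<le> A * \<epsilon>" "1 \<le> A * (\<kappa> - 1) * \<epsilon>"
    using \<epsilon> \<kappa> by (auto simp: A_def max_def field_simps)
  have 1: "real n + 6 \<le> A * f n" for n
  proof -
    have "1 * (real n + 6) \<le> A * \<epsilon> * (real n + 6)" using A by (intro mult_right_mono) auto
    also have "\<dots> \<le> A * f n" using A *[of n] by (simp add: mult.assoc)
    finally show ?thesis by simp
  qed
  have 2: "A * f n + real n + 6 \<le> A * f (n + 3)" for n
  proof -
    have "1 * (real n + 6) \<le> A * (\<kappa> - 1) * \<epsilon> * (real n + 6)" using A by (intro mult_right_mono) auto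
    also have "\<dots> = A * (\<kappa> - 1) * (\<epsilon> * (real n + 6))" by simp
    also have "\<dots> \<le> A * (\<kappa> - 1) * f n" using A \<kappa> *[of n] by (intro mult_left_mono) auto
    also have "\<dots> = A * (\<kappa> * f n) - A * f n" by (simp add: algebra_simps)
    also have "\<dots> \<le> A * f (n + 3) - A * f n" using f3[of n] A by simp
    finally show ?thesis by simp
  qed
  show ?thesis using that A(1) 1 2 by blast
qed

text \<open>\<open>g\<close> enumerates the indices where height and inverse error agree to leading
  order. \<open>bad\<close> keeps all other points at exponents bounded away from 1, and
  \<open>desc\<close> ensures that a drop of \<open>f\<close> occurs only right after a good index,
  which can then serve as a fallback.\<close>

lemma realize_exponents:
  fixes f :: "nat \<Rightarrow> real" and g :: "nat \<Rightarrow> nat"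
  assumes pos: "\<And>n. 0 < f n" and f2: "\<And>n. f n \<le> f (n + 2)"
    and \<kappa>: "1 < \<kappa>" and f3: "\<And>n. \<kappa> * f n \<le> f (n + 3)"
    and \<theta>: "0 < \<theta>" "\<theta> < 1"
    and g: "strict_mono g" "\<And>i. 2 \<le> g i" and fg: "strict_mono (\<lambda>i. f (g i))"
    and good: "\<And>n. n + 2 \<in> range g \<Longrightarrow> f (n + 2) = f (n + 1) + f n"
    and bad: "\<And>n. n + 2 \<notin> range g \<Longrightarrow> f (n + 2) \<le> \<theta> * (f (n + 1) + f n)"
    and desc: "\<And>n. f (n + 1) < f n \<Longrightarrow> n \<in> range g"
    and ratio: "(\<lambda>i. f (g i) / f (g (Suc i))) \<longlonglongrightarrow> r"
  shows "\<exists>\<xi> \<eta>. (\<xi>, \<eta>) \<in> V_set \<and> lambda_min \<xi> \<eta> = ereal r"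
proof -
  obtain A where A: "0 < A" "\<And>n. real n + 6 \<le> A * f n" "\<And>n. A * f n + real n + 6 \<le> A * f (n + 3)"
    using linear_growth[of f \<kappa>, OF pos \<kappa> f3] by blast
  define F where "F = (\<lambda>n. A * f n)"
  define k where "k = (\<lambda>n. nat \<lfloor>F n\<rfloor>)"
  define E where "E = (\<lambda>n. 2 powr F n)"
  have F: "real n + 6 \<le> F n" "F n + real n + 6 \<le> F (n + 3)" "F n \<le> F (n + 2)" for n
    using A f2 by (auto simp: F_def)
  interpret growth k
  proof
    fix n
    show "1 \<le> k n" using F(1)[of n] unfolding k_def by linarith
    show "k n \<le> k (n + 2)" using F(3)[of n] unfolding k_def by (intro nat_mono floor_mono)
    show "k n + n + 5 \<le> k (n + 3)" using F(1)[of n] F(2)[of n] unfolding k_def by linarith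
  qed
  have kF: "real (k n) \<le> F n" "F n \<le> real (k n) + 1" for n
    using F(1)[of n] unfolding k_def by linarith+
  have kE: "2 ^ k n \<le> E n" "E n \<le> 2 * 2 ^ k n" for n
  proof -
    have p: "(2::real) ^ k n = 2 powr real (k n)" by (simp add: powr_realpow)
    show "2 ^ k n \<le> E n" unfolding p E_def using kF by (intro powr_mono) auto
    have "E n \<le> 2 powr (real (k n) + 1)" unfolding E_def using kF by (intro powr_mono) auto
    then show "E n \<le> 2 * 2 ^ k n" by (simp add: p powr_add)
  qed
  have E_pos: "0 < E n" for n by (simp add: E_def)
  have E_iff: "E m \<le> E n \<longleftrightarrow> f m \<le> f n" "E m < E n \<longleftrightarrow> f m < f n" for m n
    using A by (auto simp: E_def F_def)
  have E_mult: "E m * E n = 2 powr (A * (f m + f n))" for m n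
    by (simp add: E_def F_def distrib_left powr_add)
  have E_ge: "real n \<le> E n" for n
  proof -
    have "real n \<le> 2 ^ n" using of_nat_less_two_power[of n, where ?'a = real] by simp
    also have "\<dots> = 2 powr real n" by (simp add: powr_realpow)
    also have "\<dots> \<le> E n" unfolding E_def using F(1)[of n] by (intro powr_mono) auto
    finally show ?thesis .
  qed
  have E_gt_1: "1 < E n" for n using F(1)[of n] by (simp add: E_def)
  obtain \<xi> \<eta> C0 where C0: "0 \<le> C0" "\<And>n. err \<xi> \<eta> (pt n) \<le> C0 / 2 ^ k n" by (rule limit_point) blast
  \<comment> \<open>The 2 comes from \<open>X_upper'\<close>, and \<open>2 * C0\<close> from
    replacing \<open>2 ^ k n\<close> by \<open>E n\<close>, which is at most twice as large.\<close>
  define C where "C = max 2 (2 * C0)"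
  define c where "c = 1 / (7 * C\<^sup>2)"
  have C: "2 \<le> C" "2 * C0 \<le> C" by (auto simp: C_def)
  have c: "0 < c" "6 * c * C\<^sup>2 < 1" using C by (auto simp: c_def)
  have pt_err: "err \<xi> \<eta> (pt n) \<le> C / E n" for n
  proof -
    have "C0 * E n \<le> C0 * (2 * 2 ^ k n)" using kE C0 by (intro mult_left_mono) auto
    also have "\<dots> \<le> C * 2 ^ k n" using C by simp
    finally have "C0 / 2 ^ k n \<le> C / E n" using E_pos[of n] by (simp add: field_simps)
    then show ?thesis using C0(2)[of n] by linarith
  qed
  have pt_fst: "fst (pt n) = X n" for n by (simp add: pt_def)
  have X_le: "real_of_int (X (n + 2)) \<le> C * (E n * E (n + 1))" for n
  proof -
    have "2 * (2 ^ k n * 2 ^ k (n + 1)) \<le> C * (E n * E (n + 1))"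
      using C kE E_pos by (intro mult_mono) (auto intro: less_imp_le)
    then show ?thesis using X_upper'[of n] by linarith
  qed
  \<comment> \<open>A point violating this has zero determinant with any two of three consecutive independent points.\<close>
  have exclusion: "c / max (E n) (E (n + 1)) \<le> err \<xi> \<eta> w"
    if asc: "E (n + 1) \<le> E (n + 2)" and w: "1 \<le> \<bar>fst w\<bar>" "real_of_int \<bar>fst w\<bar> < c * (E n * E (n + 1))" for n w
  proof (rule ccontr)
    assume "\<not> ?thesis"
    moreover have "c / max (E n) (E (n + 1)) \<le> c / E n" "c / max (E n) (E (n + 1)) \<le> c / E (n + 1)"
      using c E_pos[of n] E_pos[of "n + 1"] by (auto intro!: divide_left_mono mult_pos_pos simp: less_max_iff_disj)
    ultimately have e: "err \<xi> \<eta> w < c / E n" "err \<xi> \<eta> w < c / E (n + 1)" by auto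
    have h: "real_of_int \<bar>fst (pt m)\<bar> \<le> C * (E n * E (n + 1))" if "m \<le> n + 2" for m
    proof -
      have "real_of_int (X m) \<le> X (n + 2)" using X_mono[OF that] by simp
      then show ?thesis using X_le[of n] X_ge_1[of m] unfolding pt_fst by simp
    qed
    have En: "E n \<le> E (n + 2)" using f2 E_iff by blast
    have C0': "0 \<le> C" using C by simp
    have sw: "E (n + 1) * E n = E n * E (n + 1)" by simp
    have "det3 (pt n) (pt (n + 1)) w = 0"
      using E_pos[of n] E_pos[of "n + 1"] order_refl C0' pt_err h pt_err h w(2) e c
      by (rule det3_zero_of_small) auto
    moreover have "det3 (pt n) (pt (n + 2)) w = 0"
      using E_pos[of n] E_pos[of "n + 1"] asc C0' pt_err h pt_err h w(2) e c
      by (rule det3_zero_of_small) auto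
    \<comment> \<open>Here the scales \<open>E n\<close> and \<open>E (n + 1)\<close> change roles:
      the error of \<open>pt (n + 2)\<close> is compared with \<open>E n\<close>, which is at most
      \<open>E (n + 2)\<close> by \<open>f2\<close>.\<close>
    moreover have "det3 (pt (n + 1)) (pt (n + 2)) w = 0"
      using E_pos[of "n + 1"] E_pos[of n] En C0' pt_err h[folded sw] pt_err h[folded sw] w(2)[folded sw] e(2,1) c
      by (rule det3_zero_of_small) auto
    moreover have "det3 (pt n) (pt (n + 1)) (pt (n + 2)) \<noteq> 0" using det3_pt[of n] by simp
    ultimately have "w = (0, 0, 0)" by (metis det3_cramer_zero)
    with w(1) show False by simp
  qed
  \<comment> \<open>An integer relation takes integer values tending to 0 on the points, so it
    vanishes on three consecutive ones, whose determinant is 1.\<close>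
  have indep: "Q_lin_indep3 \<xi> \<eta>"
  proof (rule Q_lin_indep3_intI)
    fix a b d :: int
    assume z: "of_int a + of_int b * \<xi> + of_int d * \<eta> = 0"
    define dot where "dot = (\<lambda>n. a * X n + b * rec_seq k 0 1 0 n + d * rec_seq k 0 0 1 n)"
    define M where "M = (\<bar>real_of_int b\<bar> + \<bar>real_of_int d\<bar>) * C"
    obtain n :: nat where n: "M < real n" using reals_Archimedean2 by blast
    have "dot m = 0" if "n \<le> m" for m
    proof -
      have "\<bar>real_of_int (dot m)\<bar> \<le> (\<bar>real_of_int b\<bar> + \<bar>real_of_int d\<bar>) * err \<xi> \<eta> (pt m)"
        using abs_linear_form_le[of a "X m" b "rec_seq k 0 1 0 m" d "rec_seq k 0 0 1 m" \<xi> \<eta>]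
        unfolding z dot_def pt_def by simp
      also have "\<dots> \<le> (\<bar>real_of_int b\<bar> + \<bar>real_of_int d\<bar>) * (C / E m)"
        using pt_err by (intro mult_left_mono) auto
      also have "\<dots> = M / E m" by (simp add: M_def)
      also have "\<dots> < 1" using n that E_ge[of m] E_pos[of m] by (simp add: field_simps)
      finally show ?thesis by linarith
    qed
    then have "dot n = 0" "dot (n + 1) = 0" "dot (n + 2) = 0" by auto
    with det3_pt[of n] show "a = 0 \<and> b = 0 \<and> d = 0"
      unfolding dot_def pt_def det3.simps by (intro conjI) algebra+
  qed
  \<comment> \<open>The three bounds serve, in order, good indices, the remaining indices, and the
    case \<open>n = 0\<close> below.\<close>
  define cc where "cc = min (min c (c * c powr \<theta>)) (c / max (E 0) (E 1))"
  have cc: "0 < cc" "cc \<le> c" "cc \<le> c * c powr \<theta>" "cc \<le> c / max (E 0) (E 1)"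
    using c E_pos by (auto simp: cc_def less_max_iff_disj)
  have dich: "cc * real_of_int \<bar>fst w\<bar> powr (-\<theta>) \<le> err \<xi> \<eta> w \<or>
      (\<exists>i. cc * E (g i) \<le> real_of_int \<bar>fst w\<bar> \<and> cc / E (g i) \<le> err \<xi> \<eta> w)" if w: "1 \<le> \<bar>fst w\<bar>" for w
  proof -
    define h where "h = real_of_int \<bar>fst w\<bar>"
    have h: "1 \<le> h" using w by (simp add: h_def)
    \<comment> \<open>At the least such \<open>n\<close>, \<open>exclusion\<close> bounds the error
      from below, while minimality bounds the height from below through an earlier ascending index.
      Of two neighbouring indices one is always ascending, by \<open>f2\<close>.\<close>
    define P where "P = (\<lambda>n. E (n + 1) \<le> E (n + 2) \<and> h < c * (E n * E (n + 1)))"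
    have "\<exists>n. P n"
    proof -
      obtain N :: nat where N: "h / c < real N" using reals_Archimedean2 by blast
      have large: "h < c * (E n * E (n + 1))" if "N \<le> n" for n
      proof -
        have "h / c * 1 < E n * E (n + 1)" using N that E_ge[of n] E_gt_1[of "n + 1"] h c E_pos[of n]
          by (intro mult_strict_mono) auto
        then show ?thesis using c by (simp add: field_simps)
      qed
      show ?thesis
      proof (cases "E (N + 1) \<le> E (N + 2)")
        case True
        then show ?thesis using large[of N] by (auto simp: P_def)
      next
        case False
        moreover have "E (N + 1) \<le> E (N + 1 + 2)" using f2 E_iff by blast
        ultimately have "E (N + 1 + 1) \<le> E (N + 1 + 2)" by simp
        then show ?thesis using large[of "N + 1"] unfolding P_def by (intro exI[of _ "N + 1"]) auto
      qed
    qed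
    define n where "n = (LEAST n. P n)"
    have Pn: "P n" unfolding n_def using \<open>\<exists>n. P n\<close> by (rule LeastI_ex)
    have not_P: "c * (E m * E (m + 1)) \<le> h" if "m < n" "E (m + 1) \<le> E (m + 2)" for m
      using not_less_Least[of m P] that by (auto simp: n_def P_def)
    have low: "c / max (E n) (E (n + 1)) \<le> err \<xi> \<eta> w"
      using Pn w by (intro exclusion) (auto simp: P_def h_def)
    have near: "\<exists>i. cc * E (g i) \<le> h \<and> cc / E (g i) \<le> err \<xi> \<eta> w"
      if j: "j \<in> range g" "c * E j \<le> h" "c / E j \<le> err \<xi> \<eta> w" for j
    proof -
      obtain i where i: "j = g i" using j by blast
      have "cc * E j \<le> c * E j" "cc / E j \<le> c / E j"
        using cc E_pos[of j] by (auto intro!: mult_right_mono divide_right_mono)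
      then show ?thesis using j i by (intro exI[of _ i]) auto
    qed
    \<comment> \<open>If the predecessor \<open>m\<close> is ascending, \<open>pt (m + 2)\<close> is
      the comparison point, and it falls under \<open>good\<close> or \<open>bad\<close>. If not,
      \<open>m + 1\<close> is a good index by \<open>desc\<close>, and \<open>pt (m + 1)\<close>
      takes its place.\<close>
    consider "n = 0" | m where "n = Suc m" "E (m + 1) \<le> E (m + 2)" | m where "n = Suc m" "E (m + 2) < E (m + 1)"
      by (cases n) force+
    then have "cc * h powr (-\<theta>) \<le> err \<xi> \<eta> w \<or> (\<exists>i. cc * E (g i) \<le> h \<and> cc / E (g i) \<le> err \<xi> \<eta> w)"
    proof cases
      case 1
      have "cc * h powr (-\<theta>) \<le> cc * 1" using cc h \<theta> powr_mono[of "-\<theta>" 0 h] by (intro mult_left_mono) auto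
      also have "\<dots> \<le> c / max (E n) (E (n + 1))" using cc 1 by simp
      finally show ?thesis using low by simp
    next
      case (2 m)
      have hm: "c * (E m * E (m + 1)) \<le> h" using not_P[of m] 2 by simp
      have low': "c / E (m + 2) \<le> err \<xi> \<eta> w" using low 2 by (simp add: max_def)
      show ?thesis
      proof (cases "m + 2 \<in> range g")
        case True
        have "E (m + 2) = E m * E (m + 1)" using good[OF True] unfolding E_mult by (simp add: E_def F_def add.commute)
        then show ?thesis using near[OF True] hm low' by simp
      next
        case False
        have "A * f (m + 2) \<le> \<theta> * (A * (f m + f (m + 1)))" 
          using mult_left_mono[OF bad[OF False], of A] A(1) by (simp add: algebra_simps)
        then have "E (m + 2) \<le> (E m * E (m + 1)) powr \<theta>"
          unfolding E_mult powr_powr by (simp add: E_def F_def mult.commute)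
        also have "\<dots> \<le> (h / c) powr \<theta>"
          using hm c E_pos \<theta> by (intro powr_mono2) (auto simp: field_simps intro: less_imp_le)
        also have "\<dots> = h powr \<theta> / c powr \<theta>" using h c by (simp add: powr_divide)
        finally have "E (m + 2) * c powr \<theta> \<le> h powr \<theta>" using c by (simp add: field_simps)
        then have "c * c powr \<theta> * h powr (-\<theta>) \<le> c / E (m + 2)"
          using c h E_pos[of "m + 2"] by (simp add: powr_minus field_simps)
        moreover have "cc * h powr (-\<theta>) \<le> c * c powr \<theta> * h powr (-\<theta>)" using cc by (intro mult_right_mono) auto
        ultimately show ?thesis using low' by linarith
      qed
    next
      case (3 m)
      then have "m + 1 \<in> range g" using desc[of "m + 1"] E_iff by simp
      moreover from this have "2 \<le> m + 1" by (metis g(2) imageE)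
      then obtain j where j: "m = Suc j" by (cases m) auto
      ultimately have G: "j + 2 \<in> range g" by simp
      have s: "f (j + 2) = f (j + 1) + f j" by (rule good[OF G])
      then have "E (j + 1) \<le> E (j + 2)" using pos[of j] E_iff by simp
      then have "c * (E j * E (j + 1)) \<le> h" using not_P[of j] 3 j by simp
      moreover have "E (j + 2) = E j * E (j + 1)" using s unfolding E_mult by (simp add: E_def F_def add.commute)
      moreover have "c / E (j + 2) \<le> err \<xi> \<eta> w" using low 3 j by (simp add: max_def)
      ultimately show ?thesis using near[OF G] by simp
    qed
    then show ?thesis by (simp add: h_def)
  qed
  interpret gp: good_points \<xi> \<eta> "\<lambda>i. pt (g i)" "\<lambda>i. E (g i)" C cc \<theta> r
  proof
    show "1 \<le> C" using C by simp
    show "0 < cc" "0 < \<theta>" "\<theta> < 1" by fact+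
    show "strict_mono (\<lambda>i. E (g i))" using fg by (simp add: strict_mono_def E_iff)
    have "real i \<le> E (g i)" for i
      using E_ge[of "g i"] strict_mono_imp_increasing[OF g(1), of i] by linarith
    then show "filterlim (\<lambda>i. E (g i)) at_top sequentially"
      by (intro filterlim_at_top_mono[OF filterlim_real_sequentially]) auto
    show "1 < E (g i)" for i by (rule E_gt_1)
    show "1 \<le> fst (pt (g i))" for i by (simp add: pt_fst X_ge_1)
    show "real_of_int (fst (pt (g i))) \<le> C * E (g i)" for i
    proof -
      obtain j where j: "g i = j + 2" using g(2)[of i] by (metis add.commute le_Suc_ex)
      then have "f (j + 2) = f (j + 1) + f j" by (metis good rangeI)
      then have "E (j + 2) = E j * E (j + 1)" unfolding E_mult by (simp add: E_def F_def add.commute)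
      then show ?thesis using X_le[of j] unfolding pt_fst j by simp
    qed
    show "err \<xi> \<eta> (pt (g i)) \<le> C / E (g i)" for i by (rule pt_err)
    show "cc * real_of_int \<bar>fst w\<bar> powr (-\<theta>) \<le> err \<xi> \<eta> w \<or>
      (\<exists>i. cc * E (g i) \<le> real_of_int \<bar>fst w\<bar> \<and> cc / E (g i) \<le> err \<xi> \<eta> w)" if "1 \<le> \<bar>fst w\<bar>" for w
      by (rule dich[OF that])
    have "ln (E (g i)) / ln (E (g (Suc i))) = f (g i) / f (g (Suc i))" for i
      using A(1) by (simp add: E_def F_def ln_powr)
    then show "(\<lambda>i. ln (E (g i)) / ln (E (g (Suc i)))) \<longlonglongrightarrow> r" using ratio by simp
  qed
  show ?thesis
    using indep gp.lambda_exp_eq_1 gp.lambda_min_eq unfolding V_set_def by blast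
qed

text \<open>
  At an index of \<open>G\<close> the preceding step was multiplication by \<open>b\<close>, so the factor \<open>1 + 1 / b\<close> yields exactly the sum of the
  two preceding terms. The step down by \<open>1 / b\<close> after it is what allows limit ratios between the golden ratio and \<open>2\<close>.
\<close>

fun block_seq :: "nat set \<Rightarrow> real \<Rightarrow> nat \<Rightarrow> real" where
  "block_seq G b 0 = 1"
| "block_seq G b (Suc n) =
     block_seq G b n * (if Suc n \<in> G then 1 + 1 / b else if n \<in> G then 1 / b else b)"

text \<open>Two regimes are allowed by \<open>alt\<close>. Arbitrary gaps need \<open>b > 1\<close>
  for growth and \<open>b \<le> 3 / 2\<close> for \<open>bad\<close>; with all gaps equal to 3 the
  growth comes from \<open>1 + 1 / b\<close>, and \<open>b\<close> may range from 1 to the golden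
  ratio.\<close>

lemma realize_block_seq:
  fixes b :: real and g :: "nat \<Rightarrow> nat"
  assumes b: "1 \<le> b" and g0: "g 0 = 2" and gap: "\<And>i. g i + 3 \<le> g (Suc i)"
    and alt: "(1 < b \<and> b \<le> 3 / 2) \<or> (b\<^sup>2 \<le> b + 1 \<and> (\<forall>i. g (Suc i) = g i + 3))"
    and ratio: "(\<lambda>i. 1 / (b ^ (g (Suc i) - g i - 3) * (1 + 1 / b))) \<longlonglongrightarrow> r"
  shows "\<exists>\<xi> \<eta>. (\<xi>, \<eta>) \<in> V_set \<and> lambda_min \<xi> \<eta> = ereal r"
proof -
  define G where "G = range g"
  define f where "f = block_seq G b"
  have b2: "b\<^sup>2 \<le> b + 1" and b_lt: "b < 2"
  proof -
    have "b\<^sup>2 \<le> 3 / 2 * b" if "b \<le> 3 / 2" using that b by (simp add: power2_eq_square)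
    then show "b\<^sup>2 \<le> b + 1" using alt by auto
    then have "b * b \<le> b + 1" by (simp add: power2_eq_square)
    moreover have "2 * b \<le> b * b" if "2 \<le> b" using that by (intro mult_right_mono) auto
    ultimately show "b < 2" by linarith
  qed
  have g_less: "g i < g (Suc i)" for i using gap[of i] by linarith
  then have g_mono: "strict_mono g" by (simp add: strict_mono_Suc_iff)
  have g2: "2 \<le> g i" for i using strict_mono_less_eq[OF g_mono, of 0 i] g0 by simp
  have between: "n \<notin> G" if "g i < n" "n < g (Suc i)" for i n
  proof
    assume "n \<in> G"
    then obtain j where "n = g j" unfolding G_def by blast
    then have "i < j" "j < Suc i" using that strict_mono_less[OF g_mono] by auto
    then show False by simp
  qed
  have sep: "n + 1 \<notin> G" "n + 2 \<notin> G" if n: "n \<in> G" for n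
  proof -
    obtain i where i: "n = g i" using n unfolding G_def by blast
    show "n + 1 \<notin> G" "n + 2 \<notin> G" by (rule between[of i]; use gap[of i] i in simp)+
  qed
  have f_Suc: "f (n + 1) = f n * (if n + 1 \<in> G then 1 + 1 / b else if n \<in> G then 1 / b else b)" for n
    by (simp add: f_def)
  have f_pos: "0 < f n" for n
    using b by (induction n) (auto simp: f_def intro!: mult_pos_pos add_pos_pos)
  have fG: "f (n + 1) = f n * (1 + 1 / b)" if "n + 1 \<in> G" for n using that unfolding f_Suc by simp
  have fG': "f (n + 1) = f n * (1 / b)" if "n \<in> G" for n using that sep[of n] unfolding f_Suc by simp
  have fN: "f (n + 1) = f n * b" if "n \<notin> G" "n + 1 \<notin> G" for n using that unfolding f_Suc by simp
  have e: "n + 1 + 1 = n + 2" "n + 2 + 1 = n + 3" "n + 3 = Suc (Suc (Suc n))" for n :: nat by auto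
  have inv: "1 / b \<le> 1" "0 < 1 / b" using b by auto
  have tight: "n \<in> G \<or> n + 1 \<in> G \<or> n + 2 \<in> G" if "\<forall>i. g (Suc i) = g i + 3" for n
  proof -
    have gi: "g i = 3 * i + 2" for i by (induction i) (use that g0 in auto)
    have "n \<in> G" if "n mod 3 = 2" for n
    proof -
      have "n = g (n div 3)" using that unfolding gi by presburger
      then show ?thesis unfolding G_def by blast
    qed
    moreover have "n mod 3 = 2 \<or> (n + 1) mod 3 = 2 \<or> (n + 2) mod 3 = 2" by presburger
    ultimately show ?thesis by blast
  qed
  have f2: "f n \<le> f (n + 2)" for n
  proof -
    consider "n + 1 \<in> G" "n + 2 \<notin> G" | "n + 2 \<in> G" "n + 1 \<notin> G" "n \<notin> G"
      | "n \<in> G" "n + 1 \<notin> G" "n + 2 \<notin> G" | "n \<notin> G" "n + 1 \<notin> G" "n + 2 \<notin> G"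
      using sep[of n] sep[of "n + 1"] by (auto simp: e)
    then have "\<exists>t\<ge>1. f (n + 2) = f n * t"
    proof cases
      case 1
      \<comment> \<open>This is \<open>b\<^sup>2 \<le> b + 1\<close>: the golden ratio limits how
        far the sequence may drop after a good index.\<close>
      have "1 \<le> (1 + 1 / b) * (1 / b)" using b b2 by (simp add: field_simps power2_eq_square)
      then show ?thesis using fG[of n] fG'[of "n + 1"] 1 by (intro exI[of _ "(1 + 1 / b) * (1 / b)"]) (simp add: e)
    next
      case 2
      have "1 \<le> b * (1 + 1 / b)" using b by (simp add: field_simps)
      then show ?thesis using fN[of n] fG[of "n + 1"] 2 by (intro exI[of _ "b * (1 + 1 / b)"]) (simp add: e)
    next
      case 3
      then show ?thesis using fG'[of n] fN[of "n + 1"] b by (intro exI[of _ 1]) (simp add: e)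
    next
      case 4
      have "1 * 1 \<le> b * b" using b by (intro mult_mono) auto
      then show ?thesis using fN[of n] fN[of "n + 1"] 4 by (intro exI[of _ "b * b"]) (simp add: e)
    qed
    then obtain t where "1 \<le> t" "f (n + 2) = f n * t" by blast
    then show ?thesis using f_pos[of n] by simp
  qed
  define \<kappa> where "\<kappa> = (if \<forall>i. g (Suc i) = g i + 3 then 1 + 1 / b else min b (1 + 1 / b))"
  have \<kappa>1: "1 < \<kappa>" using alt b unfolding \<kappa>_def by auto
  have f3: "\<kappa> * f n \<le> f (n + 3)" for n
  proof -
    have k1: "\<kappa> \<le> 1 + 1 / b" by (simp add: \<kappa>_def)
    have k2: "\<kappa> \<le> b" if "\<not> (\<forall>i. g (Suc i) = g i + 3)" using that by (auto simp: \<kappa>_def)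
    consider "n + 1 \<in> G" "n + 2 \<notin> G" "n + 3 \<notin> G" | "n + 2 \<in> G" "n + 1 \<notin> G" "n \<notin> G" "n + 3 \<notin> G"
      | "n \<in> G" "n + 1 \<notin> G" "n + 2 \<notin> G" "n + 3 \<in> G" | "n \<in> G" "n + 1 \<notin> G" "n + 2 \<notin> G" "n + 3 \<notin> G"
      | "n \<notin> G" "n + 1 \<notin> G" "n + 2 \<notin> G"
      using sep[of n] sep[of "n + 1"] sep[of "n + 2"] by (auto simp: e eval_nat_numeral)
    then have "\<exists>t\<ge>\<kappa>. f (n + 3) = f n * t"
    proof cases
      case 1
      then show ?thesis using fG[of n] fG'[of "n + 1"] fN[of "n + 2"] k1 b by (intro exI[of _ "1 + 1 / b"]) (simp add: e)
    next
      case 2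
      then show ?thesis using fN[of n] fG[of "n + 1"] fG'[of "n + 2"] k1 b by (intro exI[of _ "1 + 1 / b"]) (simp add: e)
    next
      case 3
      then show ?thesis using fG'[of n] fN[of "n + 1"] fG[of "n + 2"] k1 b by (intro exI[of _ "1 + 1 / b"]) (simp add: e)
    next
      case 4
      then have "\<not> (\<forall>i. g (Suc i) = g i + 3)" using tight[of "n + 1"] by (auto simp: e)
      then show ?thesis using 4 fG'[of n] fN[of "n + 1"] fN[of "n + 2"] k2 b by (intro exI[of _ b]) (simp add: e)
    next
      case 5
      then have nt: "\<not> (\<forall>i. g (Suc i) = g i + 3)" using tight[of n] by auto
      define t where "t = (if n + 3 \<in> G then 1 + 1 / b else b)"
      have "1 \<le> t" using b by (simp add: t_def)
      then have "b * 1 * 1 \<le> b * b * t" using b by (intro mult_mono) auto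
      moreover have "f (n + 3) = f n * (b * b * t)"
        using 5 fN[of n] fN[of "n + 1"] fN[of "n + 2"] fG[of "n + 2"] by (simp add: e t_def)
      ultimately show ?thesis using k2[OF nt] by (intro exI[of _ "b * b * t"]) auto
    qed
    then obtain t where "\<kappa> \<le> t" "f (n + 3) = f n * t" by blast
    then show ?thesis using f_pos[of n] by (simp add: mult.commute)
  qed
  \<comment> \<open>The extreme case is \<open>b = 3 / 2\<close> with three consecutive indices
    outside \<open>G\<close>, where \<open>b\<^sup>2 = 9 / 10 * (b + 1)\<close>.\<close>
  define \<theta> :: real where "\<theta> = 9 / 10"
  have \<theta>: "0 < \<theta>" "\<theta> < 1" by (simp_all add: \<theta>_def)
  have good: "f (n + 2) = f (n + 1) + f n" if "n + 2 \<in> G" for n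
  proof -
    have "n \<notin> G" "n + 1 \<notin> G" using that sep[of n] sep[of "n + 1"] by (auto simp: e)
    then have "f (n + 1) = f n * b" "f (n + 2) = f (n + 1) * (1 + 1 / b)"
      using fN[of n] fG[of "n + 1"] that by (simp_all only: e not_False_eq_True)
    then show ?thesis using b by (simp add: distrib_left)
  qed
  have bad: "f (n + 2) \<le> \<theta> * (f (n + 1) + f n)" if "n + 2 \<notin> G" for n
  proof -
    consider "n + 1 \<in> G" | "n \<in> G" "n + 1 \<notin> G" | "n \<notin> G" "n + 1 \<notin> G" by blast
    then have "\<exists>s t. f (n + 1) = f n * s \<and> f (n + 2) = f n * t \<and> t \<le> \<theta> * (s + 1)"
    proof cases
      case 1
      have "(1 + 1 / b) * (1 / b) \<le> (1 + 1 / b) * 1" using inv by (intro mult_left_mono) auto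
      then have "(1 + 1 / b) * (1 / b) \<le> \<theta> * ((1 + 1 / b) + 1)" using inv unfolding \<theta>_def by argo
      then show ?thesis using 1 fG[of n] fG'[of "n + 1"]
        by (intro exI[of _ "1 + 1 / b"] exI[of _ "(1 + 1 / b) * (1 / b)"]) (simp add: e)
    next
      case 2
      have "1 \<le> \<theta> * (1 / b + 1)" using b b_lt by (simp add: \<theta>_def field_simps)
      then show ?thesis using 2 that fG'[of n] fN[of "n + 1"] b
        by (intro exI[of _ "1 / b"] exI[of _ 1]) (simp add: e)
    next
      case 3
      then have "b \<le> 3 / 2" using tight[of n] that alt by auto
      then have "b * b \<le> 3 / 2 * b" using b by (intro mult_right_mono) auto
      then have "b * b \<le> \<theta> * (b + 1)" using \<open>b \<le> 3 / 2\<close> by (simp add: \<theta>_def)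
      then show ?thesis using 3 that fN[of n] fN[of "n + 1"]
        by (intro exI[of _ b] exI[of _ "b * b"]) (simp add: e)
    qed
    then obtain s t where st: "f (n + 1) = f n * s" "f (n + 2) = f n * t" "t \<le> \<theta> * (s + 1)" by blast
    have "f n * t \<le> f n * (\<theta> * (s + 1))" using st(3) f_pos[of n] by (intro mult_left_mono) auto
    then show ?thesis using st by (simp add: algebra_simps)
  qed
  have desc: "n \<in> G" if "f (n + 1) < f n" for n
  proof (rule ccontr)
    assume "n \<notin> G"
    then have "f n * 1 \<le> f (n + 1)" using f_Suc[of n] f_pos[of n] b by (auto intro!: mult_left_mono)
    with that show False by simp
  qed
  \<comment> \<open>Between good indices there is one step by \<open>1 / b\<close>, then steps by
    \<open>b\<close>, then one by \<open>1 + 1 / b\<close>. One factor \<open>b\<close> cancels,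
    which gives the exponent gap minus 3.\<close>
  have jump: "f (g (Suc i)) = f (g i) * (b ^ (g (Suc i) - g i - 3) * (1 + 1 / b))" for i
  proof -
    have steps: "f (g i + 1 + j) = f (g i) * (1 / b * b ^ j)" if "g i + 1 + j < g (Suc i)" for j
      using that
    proof (induction j)
      case 0
      show ?case using fG'[of "g i"] by (simp add: G_def)
    next
      case (Suc j)
      have "g i + 1 + j \<notin> G" "g i + 1 + j + 1 \<notin> G" by (rule between[of i]; use Suc.prems in simp)+
      then show ?case using fN[of "g i + 1 + j"] Suc by simp
    qed
    define d where "d = g (Suc i) - g i - 3"
    have d: "g (Suc i) = g i + 1 + (d + 1) + 1" using gap[of i] by (simp add: d_def)
    have "f (g (Suc i)) = f (g i + 1 + (d + 1)) * (1 + 1 / b)"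
      unfolding d by (rule fG) (simp only: G_def rangeI flip: d)
    also have "f (g i + 1 + (d + 1)) = f (g i) * (1 / b * b ^ (d + 1))" by (rule steps) (simp add: d)
    also have "1 / b * b ^ (d + 1) = b ^ d" using b by simp
    finally show ?thesis by (simp add: d_def)
  qed
  have fg: "strict_mono (\<lambda>i. f (g i))"
  proof (simp only: strict_mono_Suc_iff, rule allI)
    fix i
    have "1 * 1 < b ^ (g (Suc i) - g i - 3) * (1 + 1 / b)" using b inv by (intro mult_le_less_imp_less) auto
    then have "f (g i) * 1 < f (g i) * (b ^ (g (Suc i) - g i - 3) * (1 + 1 / b))" using f_pos by (intro mult_strict_left_mono) auto
    then show "f (g i) < f (g (Suc i))" by (simp only: jump mult_1_right)
  qed
  have fr: "(\<lambda>i. f (g i) / f (g (Suc i))) \<longlonglongrightarrow> r"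
  proof -
    have "f (g i) / f (g (Suc i)) = 1 / (b ^ (g (Suc i) - g i - 3) * (1 + 1 / b))" for i
      using f_pos[of "g i"] unfolding jump by simp
    then show ?thesis using ratio by simp
  qed
  show ?thesis
    using f_pos f2 \<kappa>1 f3 \<theta> g_mono g2 fg good[unfolded G_def] bad[unfolded G_def] desc[unfolded G_def] fr
    by (rule realize_exponents[of f \<kappa> \<theta> g r])
qed

section \<open>The set of values\<close>

theorem theorem3:
  shows "(\<lambda>(\<xi>, \<eta>). recip_inf (lambda_min \<xi> \<eta>)) ` V_set = {ereal ((1 + sqrt 5) / 2)..}"
proof (intro equalityI subsetI)
  fix y assume "y \<in> (\<lambda>(\<xi>, \<eta>). recip_inf (lambda_min \<xi> \<eta>)) ` V_set"
  then show "y \<in> {ereal ((1 + sqrt 5) / 2)..}" using recip_lambda_min_ge by auto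
next
  fix y :: ereal assume y: "y \<in> {ereal ((1 + sqrt 5) / 2)..}"
  have "\<exists>r \<xi> \<eta>. (\<xi>, \<eta>) \<in> V_set \<and> lambda_min \<xi> \<eta> = ereal r \<and> recip_inf (ereal r) = y"
  proof (cases "y = \<infinity>")
    case True
    \<comment> \<open>Gaps growing without bound make the ratios tend to 0, which yields the value
      \<open>\<infinity>\<close>.\<close>
    define g :: "nat \<Rightarrow> nat" where "g = rec_nat 2 (\<lambda>i n. n + i + 4)"
    have g: "g 0 = 2" "g (Suc i) = g i + i + 4" for i by (simp_all add: g_def)
    have "(\<lambda>i. (1 / (3 / 2 :: real)) ^ i * (1 / (3 / 2 * (1 + 1 / (3 / 2))))) \<longlonglongrightarrow> 0"
      by (intro tendsto_mult_left_zero LIMSEQ_power_zero) auto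
    then have "(\<lambda>i. 1 / ((3 / 2 :: real) ^ (g (Suc i) - g i - 3) * (1 + 1 / (3 / 2)))) \<longlonglongrightarrow> 0"
      by (simp add: g field_simps power_divide)
    then have "\<exists>\<xi> \<eta>. (\<xi>, \<eta>) \<in> V_set \<and> lambda_min \<xi> \<eta> = ereal 0"
      by (intro realize_block_seq[of "3 / 2" g]) (auto simp: g)
    then show ?thesis using True by (force simp: recip_inf_def zero_ereal_def)
  next
    case False
    then obtain \<rho> where \<rho>: "y = ereal \<rho>" "(1 + sqrt 5) / 2 \<le> \<rho>" using y by (cases y) auto
    have "2 < sqrt (5::real)" by (rule real_less_rsqrt) simp
    then have \<rho>1: "1 < \<rho>" using \<rho> by simp
    \<comment> \<open>Constant gaps \<open>d + 3\<close> give the value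
      \<open>b ^ d * (1 + 1 / b)\<close>. For \<open>\<rho> \<le> 2\<close> take
      \<open>d = 0\<close>; for larger \<open>\<rho>\<close> fix a large \<open>d\<close> and vary
      \<open>b\<close> from 1, where the value is 2, up to \<open>3 / 2\<close>.\<close>
    have "\<exists>b d. 1 \<le> b \<and> ((1 < b \<and> b \<le> 3 / 2) \<or> (b\<^sup>2 \<le> b + 1 \<and> d = 0)) \<and> b ^ d * (1 + 1 / b) = \<rho>"
    proof (cases "\<rho> \<le> 2")
      case True
      define b where "b = 1 / (\<rho> - 1)"
      \<comment> \<open>Completing the square turns the lower bound on \<open>\<rho>\<close> into
        \<open>\<rho> + 1 \<le> \<rho>\<^sup>2\<close>, which for
        \<open>b = 1 / (\<rho> - 1)\<close> amounts to \<open>b\<^sup>2 \<le> b + 1\<close>.\<close>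
      have "((1 + sqrt 5) / 2 - 1 / 2)\<^sup>2 \<le> (\<rho> - 1 / 2)\<^sup>2" using \<rho>(2) by (intro power_mono) auto
      then have "\<rho> + 1 \<le> \<rho>\<^sup>2" by (simp add: power2_eq_square field_simps)
      then have "0 \<le> (\<rho>\<^sup>2 - (\<rho> + 1)) / (\<rho> - 1)\<^sup>2" by simp
      also have "\<dots> = b + 1 - b\<^sup>2" using \<rho>1 by (simp add: b_def power2_eq_square divide_simps) (simp add: algebra_simps)
      finally have "b\<^sup>2 \<le> b + 1" by simp
      moreover have "1 \<le> b" "1 + 1 / b = \<rho>" using \<rho>1 True by (auto simp: b_def)
      ultimately show ?thesis by (intro exI[of _ b] exI[of _ 0]) auto
    next
      case False
      obtain d where d: "\<rho> < (3 / 2) ^ d" using real_arch_pow[of "3 / 2" \<rho>] by auto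
      define h where "h = (\<lambda>b::real. b ^ d * (1 + 1 / b))"
      have "\<rho> * 1 \<le> h (3 / 2)" unfolding h_def using d False by (intro mult_mono) auto
      moreover have "h 1 \<le> \<rho>" using False by (simp add: h_def)
      moreover have "continuous_on {1..3 / 2} h" unfolding h_def by (intro continuous_intros) auto
      ultimately obtain b where b: "1 \<le> b" "b \<le> 3 / 2" "h b = \<rho>" using IVT'[of h 1 \<rho> "3 / 2"] by auto
      moreover have "b \<noteq> 1" using b False by (auto simp: h_def)
      ultimately show ?thesis by (intro exI[of _ b] exI[of _ d]) (auto simp: h_def)
    qed
    then obtain b d where b: "1 \<le> b" "(1 < b \<and> b \<le> 3 / 2) \<or> (b\<^sup>2 \<le> b + 1 \<and> d = 0)"
      "b ^ d * (1 + 1 / b) = \<rho>" by blast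
    have "\<exists>\<xi> \<eta>. (\<xi>, \<eta>) \<in> V_set \<and> lambda_min \<xi> \<eta> = ereal (1 / \<rho>)"
      using b by (intro realize_block_seq[of b "\<lambda>i. (d + 3) * i + 2"]) auto
    moreover have "recip_inf (ereal (1 / \<rho>)) = y" using \<rho> \<rho>1 by (simp add: recip_inf_def one_ereal_def)
    ultimately show ?thesis by blast
  qed
  then show "y \<in> (\<lambda>(\<xi>, \<eta>). recip_inf (lambda_min \<xi> \<eta>)) ` V_set" by force
qed

end
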